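(* Let $X_1,\dots,X_n$ be i.i.d. with distribution $P_{\theta_0}$, $\theta_0\in\Theta$, let $\pi$ be a prior on $\Theta$, and fix $\mathcal{F}\subset\mathcal{M}_1^+(\Theta)$. Assume that $\varepsilon_n>0$ is such that there is a distribution $\rho_n\in\mathcal{F}$ with $$\int \mathcal{K}(P_{\theta_0},P_{\theta})\, \rho_n(\mathrm{d}\theta) \leq \varepsilon_n,\qquad \int \mathbb{E}\left[ \log^2 \left( \frac{p_{\theta}(X_i)}{p_{\theta_0}(X_i)} \right) \right] \rho_n(\mathrm{d}\theta) \leq \varepsilon_n$$ and $$\mathcal{K}(\rho_n,\pi) \leq n \varepsilon_n .$$ Then, for any $\alpha\in(0,1)$ and any $(\varepsilon,\eta)\in(0,1)^2$, $$\mathbb{P}\left[ \int D_{\alpha}(P_{\theta},P_{\theta_0})\, \tilde{\pi}_{n,\alpha}(\mathrm{d}\theta|X_1^n) \leq \frac{(\alpha+1) \varepsilon_n + \alpha \sqrt{\frac{\varepsilon_n}{n\eta}} + \frac{\log\left(\frac{1}{\varepsilon}\right)}{n}}{1-\alpha}\right]\geq 1-\varepsilon-\eta .$$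
   Context: $\{P_\theta:\theta\in\Theta\}$ is a statistical model dominated by a measure $Q$, with densities $p_\theta=\mathrm{d}P_\theta/\mathrm{d}Q$. $\Theta$ carries a $\sigma$-algebra and $\mathcal{M}_1^+(\Theta)$ is the set of all probability measures on $\Theta$. $\mathbb{P}=P_{\theta_0}^{\otimes n}$ is the law of $X_1^n=(X_1,\dots,X_n)$ and $\mathbb{E}$ the corresponding expectation. $r_n(\theta,\theta')=\sum_{i=1}^n\log\frac{p_{\theta'}(X_i)}{p_\theta(X_i)}$; $(X_1^n,\theta)\mapsto r_n(\theta,\theta_0)$ is assumed jointly measurable (and the regularity needed for the quantities involved to be measurable is implicitly assumed). $D_\alpha(P,R)=\frac{1}{\alpha-1}\log\int\left(\frac{\mathrm{d}P}{\mathrm{d}\mu}\right)^\alpha\left(\frac{\mathrm{d}R}{\mathrm{d}\mu}\right)^{1-\alpha}\mathrm{d}\mu$ for any $\mu$ dominating $P,R$. $\mathcal{K}(P,R)=\int\log\frac{\mathrm{d}P}{\mathrm{d}R}\,\mathrm{d}P$ if $P\ll R$, $+\infty$ otherwise. Tempered posterior: $\pi_{n,\alpha}(\mathrm{d}\theta|X_1^n)\propto e^{-\alpha r_n(\theta,\theta_0)}\pi(\mathrm{d}\theta)\propto\left(\prod_i p_\theta(X_i)\right)^\alpha\pi(\mathrm{d}\theta)$. Variational approximation: $\tilde\pi_{n,\alpha}(\cdot|X_1^n)=\arg\min_{\rho\in\mathcal{F}}\mathcal{K}(\rho,\pi_{n,\alpha}(\cdot|X_1^n))$, equivalently $\tilde\pi_{n,\alpha}(\cdot|X_1^n)=\arg\min_{\rho\in\mathcal{F}}\left\{\alpha\int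 r_n(\theta,\theta_0)\rho(\mathrm{d}\theta)+\mathcal{K}(\rho,\pi)\right\}$; a minimizer is assumed to exist and $\tilde\pi_{n,\alpha}$ denotes any such minimizer. (An indeterminate $\infty-\infty$ value of $\alpha\int r_n\mathrm{d}\rho+\mathcal{K}(\rho,\pi)$ is read as $+\infty$.) *)

theory Defs
  imports "HOL-Probability.Probability"
begin

text \<open>
  Logarithms of likelihood ratios take the values \<open>\<plusminus>\<infinity>\<close> where a density vanishes; the library's
  real logarithm (with \<open>ln 0 = 0\<close>) would make such points look harmless.
\<close>

definition ln_ext :: "ennreal \<Rightarrow> ereal" where
  "ln_ext t = (if t = 0 then - \<infinity> else if t = \<infinity> then \<infinity> else ereal (ln (enn2real t)))"

text \<open>
  Integral of an extended-real function as positive part minus negative part.  In \<^typ>\<open>ereal\<close>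
  one has \<open>\<infinity> - \<infinity> = \<infinity>\<close>, so an indeterminate integral has the value \<open>\<infinity>\<close>.
\<close>

definition ext_integral :: "'a measure \<Rightarrow> ('a \<Rightarrow> ereal) \<Rightarrow> ereal" where
  "ext_integral M f =
     enn2ereal (\<integral>\<^sup>+ x. e2ennreal (f x) \<partial>M) - enn2ereal (\<integral>\<^sup>+ x. e2ennreal (- f x) \<partial>M)"

text \<open>
  The library's \<open>KL_divergence\<close> is a real-valued Bochner integral, hence \<open>0\<close> whenever the true
  divergence is infinite; the extended-valued divergence is needed here.
\<close>

definition KL_ext :: "'a measure \<Rightarrow> 'a measure \<Rightarrow> ereal" where
  "KL_ext P R =
     (if absolutely_continuous R P then ext_integral P (\<lambda>x. ln_ext (RN_deriv R P x)) else \<infinity>)"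

text \<open>
  The divergence of order \<open>\<alpha> \<in> (0, 1)\<close>, computed with a measure \<open>\<mu>\<close> dominating both \<open>P\<close> and \<open>R\<close>;
  the value does not depend on which one.  For mutually singular \<open>P\<close> and \<open>R\<close> it is
  \<open>(1 / (\<alpha> - 1)) * (- \<infinity>) = \<infinity>\<close>.
\<close>

definition renyi_divergence :: "'a measure \<Rightarrow> real \<Rightarrow> 'a measure \<Rightarrow> 'a measure \<Rightarrow> ereal" where
  "renyi_divergence \<mu> \<alpha> P R =
     ereal (1 / (\<alpha> - 1)) *
       ln_ext (\<integral>\<^sup>+ x. ennreal (enn2real (RN_deriv \<mu> P x) powr \<alpha> *
                             enn2real (RN_deriv \<mu> R x) powr (1 - \<alpha>)) \<partial>\<mu>)"

text \<open>The sample \<open>x\<close> is indexed by \<open>{1..n}\<close>.  Division is that of \<^typ>\<open>ennreal\<close>: \<open>a / 0 = \<infinity>\<close>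
  for \<open>a > 0\<close>.\<close>

definition log_lik_ratio ::
  "('t \<Rightarrow> 'x \<Rightarrow> real) \<Rightarrow> nat \<Rightarrow> 't \<Rightarrow> 't \<Rightarrow> (nat \<Rightarrow> 'x) \<Rightarrow> ereal" where
  "log_lik_ratio p n \<theta> \<theta>' x =
     (\<Sum>i\<in>{1..n}. ln_ext (ennreal (p \<theta>' (x i)) / ennreal (p \<theta> (x i))))"

definition tempered_posterior ::
  "('t \<Rightarrow> 'x \<Rightarrow> real) \<Rightarrow> nat \<Rightarrow> real \<Rightarrow> 't measure \<Rightarrow> (nat \<Rightarrow> 'x) \<Rightarrow> 't measure" where
  "tempered_posterior p n \<alpha> \<pi> x =
     density \<pi> (\<lambda>\<theta>. ennreal ((\<Prod>i\<in>{1..n}. p \<theta> (x i)) powr \<alpha>) /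
       (\<integral>\<^sup>+ \<theta>'. ennreal ((\<Prod>i\<in>{1..n}. p \<theta>' (x i)) powr \<alpha>) \<partial>\<pi>))"

text \<open>
  The two disjuncts are the two usual descriptions of the approximation (projection of the tempered
  posterior in Kullback--Leibler divergence; minimizer of the penalized log-likelihood).  For
  almost every sample they can differ only through measures \<open>\<rho>\<close> with \<open>KL_ext \<rho> \<pi> = \<infinity>\<close> whose second objective is of the form
  \<open>\<infinity> - \<infinity>\<close>, read as \<open>\<infinity>\<close>; a minimizer in either sense is admitted.
\<close>

definition variational_approximation ::
  "('t \<Rightarrow> 'x \<Rightarrow> real) \<Rightarrow> 't \<Rightarrow> nat \<Rightarrow> real \<Rightarrow> 't measure \<Rightarrow> 't measure set \<Rightarrow>
    (nat \<Rightarrow> 'x) \<Rightarrow> 't measure \<Rightarrow> bool" where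
  "variational_approximation p \<theta>0 n \<alpha> \<pi> F x \<rho>' \<longleftrightarrow>
     is_arg_min (\<lambda>\<rho>. KL_ext \<rho> (tempered_posterior p n \<alpha> \<pi> x)) (\<lambda>\<rho>. \<rho> \<in> F) \<rho>' \<or>
     is_arg_min (\<lambda>\<rho>. ereal \<alpha> * ext_integral \<rho> (\<lambda>\<theta>. log_lik_ratio p n \<theta> \<theta>0 x) + KL_ext \<rho> \<pi>)
       (\<lambda>\<rho>. \<rho> \<in> F) \<rho>'"

end

theory Submission
  imports Defs
begin

text \<open>
  Write \<open>r\<close> for the log-likelihood ratio and \<open>G \<theta> = E [exp (- \<alpha> r(\<theta>))]\<close>; by independence
  \<open>- ln (G \<theta>) = n (1 - \<alpha>) D(\<theta>)\<close> with \<open>D\<close> the Renyi divergence.  Fubini and Markov give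
  \<open>\<integral> exp (- \<alpha> r) / G d\<pi> \<le> 1 / \<epsilon>\<close> with probability at least \<open>1 - \<epsilon>\<close>, and then the Donsker--Varadhan
  inequality relative to the tempered posterior bounds \<open>\<integral> - ln G d\<rho>\<close> simultaneously for all \<open>\<rho>\<close> by
  \<open>\<alpha> \<integral> r d\<rho> + KL(\<rho>, \<pi>) + ln (1 / \<epsilon>)\<close>.  At the variational approximation the right-hand side is at
  most its value at \<open>\<rho>n\<close>, where Chebyshev's inequality, with the variance of \<open>\<integral> r d\<rho>n\<close> at most
  \<open>n \<epsilon>n\<close> by Jensen's inequality, bounds \<open>\<integral> r d\<rho>n\<close> with probability at least \<open>1 - \<eta>\<close>.
\<close>

section \<open>Extended integrals and Kullback--Leibler divergence\<close>

text \<open>Two obstacles shape the proof. The first is measurability: in the parameter it is given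
  only through the log-likelihood ratio \<open>r\<close>. The single-observation second moment and
  the Kullback-Leibler divergence are not known to be measurable in \<theta>, so the hypotheses on
  \<open>\<rho>n\<close> are turned at once into bounds on sample integrals of \<open>r\<close>, and
  the Renyi divergence is reached through \<open>G\<close>, an integral of a function of
  \<open>r\<close>. The second is infinite values. The squared-logarithm hypothesis makes
  \<open>r\<close> finite almost everywhere and square-integrable on the product, which licenses
  Fubini; the divergence hypothesis then bounds its mean. On the first event the finite exponential
  moment forces \<open>G > 0\<close> almost everywhere under every distribution with finite
  divergence from the tempered posterior, so mutually singular \<open>P \<theta>\<close> and
  \<open>P \<theta>0\<close> do no harm. Both kinds of minimizer are reduced to a bound on the
  divergence from the tempered posterior, whose log-normalizer cancels in the end.\<close>

lemma ln_ext_ennreal: "ln_ext (ennreal t) = (if 0 < t then ereal (ln t) else - \<infinity>)"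
  by (auto simp: ln_ext_def ennreal_eq_0_iff)

lemma measurable_ln_ext [measurable]: "ln_ext \<in> borel_measurable borel"
  unfolding ln_ext_def by measurable

lemma ext_integral_eq_integral:
  fixes g :: "'a \<Rightarrow> real"
  assumes "integrable M g" and "AE x in M. f x = ereal (g x)"
  shows "ext_integral M f = ereal (\<integral>x. g x \<partial>M)"
proof -
  have "(\<integral>\<^sup>+ x. e2ennreal (f x) \<partial>M) = (\<integral>\<^sup>+ x. ennreal (g x) \<partial>M)"
    using assms(2) by (intro nn_integral_cong_AE) auto
  moreover have "(\<integral>\<^sup>+ x. e2ennreal (- f x) \<partial>M) = (\<integral>\<^sup>+ x. ennreal (- g x) \<partial>M)"
    using assms(2) by (intro nn_integral_cong_AE) auto
  moreover have "enn2ereal u - enn2ereal v = ereal (enn2real u - enn2real v)"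
    if "u \<noteq> \<infinity>" "v \<noteq> \<infinity>" for u v
    using that by (cases u; cases v) auto
  ultimately show ?thesis
    using assms(1) by (simp add: ext_integral_def real_lebesgue_integral_def real_integrable_def)
qed

text \<open>An infinite positive part gives the value \<infinity> whatever the negative part is, by
  the convention for \<infinity> - \<infinity>. The negative part may still be infinite
  here.\<close>

lemma ext_integral_pos_part_finite:
  assumes "ext_integral M f < \<infinity>"
  shows "(\<integral>\<^sup>+ x. e2ennreal (f x) \<partial>M) < \<infinity>"
proof (rule ccontr)
  assume "\<not> ?thesis"
  then have "(\<integral>\<^sup>+ x. e2ennreal (f x) \<partial>M) = \<infinity>"
    by (simp add: less_top[symmetric])
  with assms show False
    by (simp add: ext_integral_def)
qed

lemma ext_integral_nonneg:
  assumes "\<And>x. x \<in> space M \<Longrightarrow> 0 \<le> f x"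
  shows "ext_integral M f = enn2ereal (\<integral>\<^sup>+ x. e2ennreal (f x) \<partial>M)"
proof -
  have "(\<integral>\<^sup>+ x. e2ennreal (- f x) \<partial>M) = (\<integral>\<^sup>+ x. 0 \<partial>M)"
    using assms by (intro nn_integral_cong) (simp add: e2ennreal_neg)
  then show ?thesis
    by (simp add: ext_integral_def zero_ennreal.rep_eq)
qed

text \<open>Change of reference measure. The first almost-everywhere hypothesis says that
  \<open>f\<close> vanishes wherever \<open>g\<close> does, up to a null set, so the quotient by 0
  is harmless; finiteness of \<open>g\<close> permits cancellation.\<close>

lemma density_divide:
  fixes f g :: "'a \<Rightarrow> ennreal"
  assumes [measurable]: "f \<in> borel_measurable M" "g \<in> borel_measurable M"
    and "AE x in density M f. 0 < g x" and "AE x in M. g x < \<infinity>"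
  shows "density (density M g) (\<lambda>x. f x / g x) = density M f"
proof -
  have "AE x in M. g x * (f x / g x) = f x"
    using assms(4) assms(3)[unfolded AE_density[OF assms(1)]]
  proof eventually_elim
    case (elim x)
    then show ?case
    proof (cases "g x = 0")
      case False
      then have "g x * (f x / g x) = g x * f x / g x"
        by (simp add: ennreal_times_divide)
      also have "\<dots> = f x"
        using False elim by (simp add: mult.commute[of "g x"] ennreal_mult_divide_eq)
      finally show ?thesis .
    qed (use elim in \<open>auto simp: zero_less_iff_neq_zero\<close>)
  qed
  then show ?thesis
    by (subst density_density_eq) (auto intro!: density_cong)
qed

section \<open>Radon-Nikodym derivatives and the Donsker-Varadhan inequality\<close>

context
  fixes P R :: "'a measure"
  assumes P: "prob_space P" and R: "finite_measure R" and sets_eq: "sets P = sets R"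
begin

interpretation P: prob_space P by (rule P)
interpretation R: finite_measure R by (rule R)

lemma RN_deriv_pos_finite:
  assumes "absolutely_continuous R P"
  shows "AE x in P. 0 < RN_deriv R P x \<and> RN_deriv R P x < \<infinity>"
proof -
  have dens: "density R (RN_deriv R P) = P"
    using assms sets_eq by (rule R.density_RN_deriv)
  have "AE x in R. RN_deriv R P x \<noteq> \<infinity>"
    using assms sets_eq by (intro R.RN_deriv_finite) unfold_locales
  then have "AE x in density R (RN_deriv R P). 0 < RN_deriv R P x \<and> RN_deriv R P x < \<infinity>"
    by (subst AE_density) (auto simp: less_top)
  then show ?thesis
    unfolding dens .
qed

text \<open>Equality can fail because \<open>P\<close> does not see the points where the derivative
  is 0, while \<open>R\<close> may charge them.\<close>

lemma nn_integral_divide_RN_deriv_le: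
  assumes "absolutely_continuous R P" and [measurable]: "u \<in> borel_measurable R"
  shows "(\<integral>\<^sup>+ x. u x / RN_deriv R P x \<partial>P) \<le> (\<integral>\<^sup>+ x. u x \<partial>R)"
proof -
  \<comment> \<open>For \<open>a = 0\<close> and for \<open>a = \<infinity>\<close> the left-hand
    side is 0; otherwise it equals \<open>b\<close>.\<close>
  have le: "a * (b / a) \<le> b" for a b :: ennreal
    by (cases "a = 0"; cases "a = \<infinity>")
      (auto simp: ennreal_divide_times mult_divide_eq_ennreal ennreal_times_divide mult.commute[of a])
  have "(\<integral>\<^sup>+ x. u x / RN_deriv R P x \<partial>P) =
      (\<integral>\<^sup>+ x. RN_deriv R P x * (u x / RN_deriv R P x) \<partial>R)"
    using assms(1) sets_eq by (intro R.RN_deriv_nn_integral) auto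
  also have "\<dots> \<le> (\<integral>\<^sup>+ x. u x \<partial>R)"
    by (intro nn_integral_mono le)
  finally show ?thesis .
qed

text \<open>By \<open>- ln t \<le> 1 / t\<close>, the negative part is dominated by the inverse
  derivative, whose \<open>P\<close>-integral is at most the total mass of \<open>R\<close>. Hence
  the divergence is never indeterminate.\<close>

lemma nn_integral_neg_ln_RN_deriv:
  assumes ac: "absolutely_continuous R P"
  shows "(\<integral>\<^sup>+ x. ennreal (- ln (enn2real (RN_deriv R P x))) \<partial>P) < \<infinity>"
proof -
  let ?f = "RN_deriv R P" and ?l = "\<lambda>x. ln (enn2real (RN_deriv R P x))"
  have "(\<integral>\<^sup>+ x. ennreal (- ?l x) \<partial>P) \<le> (\<integral>\<^sup>+ x. 1 / ?f x \<partial>P)"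
  proof (intro nn_integral_mono_AE)
    show "AE x in P. ennreal (- ?l x) \<le> 1 / ?f x"
      using RN_deriv_pos_finite[OF ac]
    proof eventually_elim
      case (elim x)
      then obtain t where t: "?f x = ennreal t" "0 < t"
        by (cases "?f x") auto
      have "- ln t \<le> 1 / t"
        using ln_le_minus_one[of "1 / t"] t by (simp add: ln_div)
      then show ?case
        using t by (simp add: divide_ennreal flip: ennreal_1)
    qed
  qed
  also have "\<dots> \<le> (\<integral>\<^sup>+ x. 1 \<partial>R)"
    using ac by (intro nn_integral_divide_RN_deriv_le) auto
  also have "\<dots> < \<infinity>"
    by (simp add: less_top[symmetric])
  finally show ?thesis .
qed

text \<open>A finite value controls the positive part of the log-derivative; the negative part is
  always integrable. From here on one can compute with a real Bochner integral.\<close>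

lemma KL_ext_finite:
  assumes "KL_ext P R < \<infinity>"
  shows "absolutely_continuous R P"
    and "integrable P (\<lambda>x. ln (enn2real (RN_deriv R P x)))"
    and "KL_ext P R = ereal (\<integral>x. ln (enn2real (RN_deriv R P x)) \<partial>P)"
proof -
  let ?f = "RN_deriv R P" and ?l = "\<lambda>x. ln (enn2real (RN_deriv R P x))"
  have [measurable_cong]: "sets P = sets R" by (rule sets_eq)
  show ac: "absolutely_continuous R P"
    using assms by (auto simp: KL_ext_def split: if_splits)
  have l: "AE x in P. ln_ext (?f x) = ereal (?l x)"
    using RN_deriv_pos_finite[OF ac] by eventually_elim (auto simp: ln_ext_def)
  have "(\<integral>\<^sup>+ x. e2ennreal (ln_ext (?f x)) \<partial>P) < \<infinity>"
    using assms ac by (intro ext_integral_pos_part_finite) (simp add: KL_ext_def)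
  also have "(\<integral>\<^sup>+ x. e2ennreal (ln_ext (?f x)) \<partial>P) = (\<integral>\<^sup>+ x. ennreal (?l x) \<partial>P)"
    using l by (intro nn_integral_cong_AE) auto
  finally show int: "integrable P ?l"
    using nn_integral_neg_ln_RN_deriv[OF ac] by (simp add: real_integrable_def less_top)
  show "KL_ext P R = ereal (\<integral>x. ?l x \<partial>P)"
    using ac ext_integral_eq_integral[OF int l] by (simp add: KL_ext_def)
qed

text \<open>The tangent-line bound \<open>d - ln f \<le> ln C - 1 + exp d / (f * C)\<close> is integrated against \<open>P\<close>.\<close>

lemma Donsker_Varadhan:
  assumes KL: "KL_ext P R < \<infinity>" and [measurable]: "d \<in> borel_measurable R"
    and d: "\<And>x. 0 \<le> d x" and "0 < C"
    and exp_le: "(\<integral>\<^sup>+ x. ennreal (exp (d x)) \<partial>R) \<le> ennreal C"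
  shows "integrable P d" and "ereal (\<integral>x. d x \<partial>P) \<le> KL_ext P R + ereal (ln C)"
proof -
  let ?f = "\<lambda>x. enn2real (RN_deriv R P x)"
  have [measurable_cong]: "sets P = sets R" by (rule sets_eq)
  note ac = KL_ext_finite(1)[OF KL]
  define e where "e x = exp (d x) / ?f x" for x
  have [measurable]: "e \<in> borel_measurable P"
    unfolding e_def by measurable
  have e_nonneg: "0 \<le> e x" for x
    by (simp add: e_def)
  have "(\<integral>\<^sup>+ x. ennreal (e x) \<partial>P) =
      (\<integral>\<^sup>+ x. ennreal (exp (d x)) / RN_deriv R P x \<partial>P)"
  proof (intro nn_integral_cong_AE)
    show "AE x in P. ennreal (e x) = ennreal (exp (d x)) / RN_deriv R P x"
      using RN_deriv_pos_finite[OF ac]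
    proof eventually_elim
      case (elim x)
      then show ?case
        by (cases "RN_deriv R P x") (auto simp: divide_ennreal e_def)
    qed
  qed
  also have "\<dots> \<le> (\<integral>\<^sup>+ x. ennreal (exp (d x)) \<partial>R)"
    using ac by (intro nn_integral_divide_RN_deriv_le) auto
  also note exp_le
  finally have le: "(\<integral>\<^sup>+ x. ennreal (e x) \<partial>P) \<le> ennreal C" .
  then have int_e: "integrable P e"
    by (intro integrableI_nonneg) (auto simp: order_le_less_trans e_def)
  have le_e: "(\<integral>x. e x \<partial>P) \<le> C"
    using le \<open>0 < C\<close> nn_integral_eq_integral[OF int_e] by (simp add: e_nonneg ennreal_le_iff)
  let ?u = "\<lambda>x. ln (?f x) + (ln C - 1) + e x / C"
  have int_u: "integrable P ?u"
    using KL_ext_finite(2)[OF KL] int_e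
    by auto
  have le_u: "AE x in P. d x \<le> ?u x"
    using RN_deriv_pos_finite[OF ac]
  proof eventually_elim
    case (elim x)
    then have "0 < ?f x"
      by (auto simp: enn2real_positive_iff)
    then show ?case
      using ln_le_minus_one[of "e x / C"] \<open>0 < C\<close> by (simp add: e_def ln_div ln_mult)
  qed
  \<comment> \<open>Since \<open>d\<close> is nonnegative, the one-sided bound is a domination, so
    integrability of \<open>d\<close> is a conclusion.\<close>
  show int: "integrable P d"
  proof (rule Bochner_Integration.integrable_bound[OF int_u])
    show "AE x in P. norm (d x) \<le> norm (?u x)"
      using le_u by eventually_elim (use d in \<open>auto intro: order_trans\<close>)
  qed auto
  have "(\<integral>x. d x \<partial>P) \<le> (\<integral>x. ?u x \<partial>P)"
    using int int_u le_u by (rule integral_mono_AE)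
  also have "\<dots> = (\<integral>x. ln (?f x) \<partial>P) + (ln C - 1) + (\<integral>x. e x \<partial>P) / C"
    using KL_ext_finite(2)[OF KL] int_e by (simp add: P.prob_space)
  \<comment> \<open>The integral of \<open>e\<close> divided by \<open>C\<close> is at most 1 and
    cancels the \<open>- 1\<close>.\<close>
  also have "\<dots> \<le> (\<integral>x. ln (?f x) \<partial>P) + ln C"
    using le_e \<open>0 < C\<close> by simp
  finally show "ereal (\<integral>x. d x \<partial>P) \<le> KL_ext P R + ereal (ln C)"
    by (simp add: KL_ext_finite(3)[OF KL])
qed

end

text \<open>The case \<open>d = 0\<close>, \<open>C = 1\<close> of the Donsker-Varadhan
  inequality.\<close>

lemma KL_ext_nonneg:
  assumes "prob_space P" "prob_space R" "sets P = sets R"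
  shows "0 \<le> KL_ext P R"
proof (cases "KL_ext P R < \<infinity>")
  case True
  interpret R: prob_space R by fact
  show ?thesis
    using Donsker_Varadhan(2)[OF assms(1) R.finite_measure_axioms assms(3) True, of "\<lambda>_. 0" 1]
    by (simp add: R.emeasure_space_1 zero_ereal_def[symmetric])
qed auto

section \<open>Sums of independent identically distributed variables\<close>

context
  fixes M :: "'a measure" and I :: "'i set" and l :: "'a \<Rightarrow> real"
  assumes M: "prob_space M" and I: "finite I" and l: "integrable M l"
begin

interpretation M: prob_space M by (rule M)
interpretation product_prob_space "\<lambda>_. M" I by unfold_locales
interpretation finite_product_prob_space "\<lambda>_. M" I by unfold_locales (rule I)

lemma PiM_integral_component:
  assumes "i \<in> I" and [measurable]: "h \<in> borel_measurable M"
  shows "integrable (PiM I (\<lambda>_. M)) (\<lambda>x. h (x i)) \<longleftrightarrow> integrable M (h :: 'a \<Rightarrow> real)"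
    and "(\<integral>x. h (x i) \<partial>PiM I (\<lambda>_. M)) = (\<integral>y. h y \<partial>M)"
proof -
  have eq: "distr (PiM I (\<lambda>_. M)) M (\<lambda>x. x i) = M"
    using assms(1) by (rule PiM_component)
  show "integrable (PiM I (\<lambda>_. M)) (\<lambda>x. h (x i)) \<longleftrightarrow> integrable M h"
    using integrable_distr_eq[of "\<lambda>x. x i" "PiM I (\<lambda>_. M)" M h] assms by (simp add: eq)
  show "(\<integral>x. h (x i) \<partial>PiM I (\<lambda>_. M)) = (\<integral>y. h y \<partial>M)"
    using integral_distr[of "\<lambda>x. x i" "PiM I (\<lambda>_. M)" M h] assms by (simp add: eq)
qed

lemma integral_PiM_sum:
  shows "integrable (PiM I (\<lambda>_. M)) (\<lambda>x. \<Sum>i\<in>I. l (x i))"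
    and "(\<integral>x. (\<Sum>i\<in>I. l (x i)) \<partial>PiM I (\<lambda>_. M)) = card I * (\<integral>y. l y \<partial>M)"
proof -
  have int: "integrable (PiM I (\<lambda>_. M)) (\<lambda>x. l (x i))" if "i \<in> I" for i
    using PiM_integral_component(1)[OF that] l by auto
  show "integrable (PiM I (\<lambda>_. M)) (\<lambda>x. \<Sum>i\<in>I. l (x i))"
    using int by (rule Bochner_Integration.integrable_sum)
  show "(\<integral>x. (\<Sum>i\<in>I. l (x i)) \<partial>PiM I (\<lambda>_. M)) = card I * (\<integral>y. l y \<partial>M)"
    using int l by (subst Bochner_Integration.integral_sum) (auto simp: PiM_integral_component(2))
qed

text \<open>After centring, the square of the sum is a double sum whose off-diagonal terms have
  integral 0 by independence.\<close>

lemma variance_PiM_sum: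
  assumes sq: "integrable M (\<lambda>y. (l y)\<^sup>2)"
  defines "m \<equiv> card I * (\<integral>y. l y \<partial>M)"
  shows "integrable (PiM I (\<lambda>_. M)) (\<lambda>x. ((\<Sum>i\<in>I. l (x i)) - m)\<^sup>2)"
    and "(\<integral>x. ((\<Sum>i\<in>I. l (x i)) - m)\<^sup>2 \<partial>PiM I (\<lambda>_. M)) = card I * M.variance l"
proof -
  define Y where "Y y = l y - M.expectation l" for y
  have Y: "integrable M Y" "M.expectation Y = 0"
    using l unfolding Y_def by (auto simp: M.prob_space)
  have Y2: "integrable M (\<lambda>y. (Y y)\<^sup>2)"
    using l sq by (simp add: Y_def power2_diff)
  have split: "((\<Sum>i\<in>I. l (x i)) - m)\<^sup>2 = (\<Sum>i\<in>I. \<Sum>j\<in>I. Y (x i) * Y (x j))" for x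
  proof -
    have "(\<Sum>i\<in>I. l (x i)) - m = (\<Sum>i\<in>I. Y (x i))"
      by (simp add: Y_def m_def sum_subtractf)
    then show ?thesis
      by (simp add: power2_eq_square sum_product)
  qed
  have cross: "integrable (PiM I (\<lambda>_. M)) (\<lambda>x. Y (x i) * Y (x j)) \<and>
      (\<integral>x. Y (x i) * Y (x j) \<partial>PiM I (\<lambda>_. M)) = (if i = j then M.variance l else 0)"
    if ij: "i \<in> I" "j \<in> I" for i j
  proof (cases "i = j")
    case True
    then show ?thesis
      using PiM_integral_component[OF ij(1), of "\<lambda>y. (Y y)\<^sup>2"] Y Y2
      by (simp add: Y_def power2_eq_square)
  next
    case False
    \<comment> \<open>Padding with the constant 1 writes \<open>Y (x i) * Y (x j)\<close> as a
      product over all coordinates, to which the product formula applies; the factor at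
      \<open>i\<close> has mean 0.\<close>
    define h where "h k = (if k = i \<or> k = j then Y else (\<lambda>_. 1))" for k
    have h: "integrable M (h k)" for k
      using Y by (simp add: h_def)
    have "(\<Prod>k\<in>I. h k (x k)) = Y (x i) * Y (x j)" for x
    proof -
      have "(\<Prod>k\<in>I. h k (x k)) = (\<Prod>k\<in>{i, j}. h k (x k))"
        using I ij by (intro prod.mono_neutral_right) (auto simp: h_def)
      then show ?thesis
        using False by (simp add: h_def)
    qed
    moreover have "(\<Prod>k\<in>I. integral\<^sup>L M (h k)) = 0"
      using I ij Y by (auto simp: h_def intro!: bexI[of _ i])
    ultimately show ?thesis
      using product_integrable_prod[of I h] product_integral_prod[of I h] h I False by simp
  qed
  show "integrable (PiM I (\<lambda>_. M)) (\<lambda>x. ((\<Sum>i\<in>I. l (x i)) - m)\<^sup>2)"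
    using cross by (simp add: split)
  show "(\<integral>x. ((\<Sum>i\<in>I. l (x i)) - m)\<^sup>2 \<partial>PiM I (\<lambda>_. M)) = card I * M.variance l"
    using cross I by (simp add: split)
qed

lemma variance_PiM_sum_le:
  assumes sq: "integrable M (\<lambda>y. (l y)\<^sup>2)"
  shows "(\<integral>x. ((\<Sum>i\<in>I. l (x i)) - card I * (\<integral>y. l y \<partial>M))\<^sup>2 \<partial>PiM I (\<lambda>_. M)) \<le>
    card I * (\<integral>y. (l y)\<^sup>2 \<partial>M)"
  unfolding variance_PiM_sum(2)[OF sq] M.variance_eq[OF l sq]
  by (intro mult_left_mono) auto

text \<open>The second moment is \<open>card I\<close> times the variance plus the squared mean;
  replacing \<open>card I\<close> by its square in the first term gives the bound. This quadratic
  bound serves integrability on the product space, while the final rate comes from the linear bound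
  on the variance.\<close>

lemma second_moment_PiM_sum:
  assumes sq: "integrable M (\<lambda>y. (l y)\<^sup>2)"
  shows "integrable (PiM I (\<lambda>_. M)) (\<lambda>x. (\<Sum>i\<in>I. l (x i))\<^sup>2)"
    and "(\<integral>x. (\<Sum>i\<in>I. l (x i))\<^sup>2 \<partial>PiM I (\<lambda>_. M)) \<le> (real (card I))\<^sup>2 * (\<integral>y. (l y)\<^sup>2 \<partial>M)"
proof -
  define S where "S x = (\<Sum>i\<in>I. l (x i))" for x
  define m where "m = card I * (\<integral>y. l y \<partial>M)"
  have S: "integrable (PiM I (\<lambda>_. M)) S" "(\<integral>x. S x \<partial>PiM I (\<lambda>_. M)) = m"
    using integral_PiM_sum by (auto simp: S_def[abs_def] m_def)
  have var: "integrable (PiM I (\<lambda>_. M)) (\<lambda>x. (S x - m)\<^sup>2)"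
      "(\<integral>x. (S x - m)\<^sup>2 \<partial>PiM I (\<lambda>_. M)) = card I * M.variance l"
    using variance_PiM_sum[OF sq] by (auto simp: S_def[abs_def] m_def)
  have "integrable (PiM I (\<lambda>_. M)) (\<lambda>x. (S x - m)\<^sup>2 + 2 * m * S x - m\<^sup>2)"
    using var(1) S(1) by auto
  moreover have "(S x - m)\<^sup>2 + 2 * m * S x - m\<^sup>2 = (S x)\<^sup>2" for x
    by (simp add: power2_diff)
  ultimately have int: "integrable (PiM I (\<lambda>_. M)) (\<lambda>x. (S x)\<^sup>2)"
    by simp
  then show "integrable (PiM I (\<lambda>_. M)) (\<lambda>x. (\<Sum>i\<in>I. l (x i))\<^sup>2)"
    by (simp add: S_def)
  have "(\<integral>x. (S x)\<^sup>2 \<partial>PiM I (\<lambda>_. M)) = card I * M.variance l + m\<^sup>2"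
    using P.variance_eq[OF S(1) int] S(2) var(2) by simp
  also have "\<dots> \<le> (real (card I))\<^sup>2 * M.variance l + m\<^sup>2"
  proof (intro add_right_mono mult_right_mono M.variance_positive)
    show "real (card I) \<le> (real (card I))\<^sup>2"
      by (cases "card I = 0") (auto simp: power2_eq_square)
  qed
  also have "\<dots> = (real (card I))\<^sup>2 * (\<integral>y. (l y)\<^sup>2 \<partial>M)"
    unfolding M.variance_eq[OF l sq] m_def by (simp add: algebra_simps power_mult_distrib)
  finally show "(\<integral>x. (\<Sum>i\<in>I. l (x i))\<^sup>2 \<partial>PiM I (\<lambda>_. M)) \<le>
      (real (card I))\<^sup>2 * (\<integral>y. (l y)\<^sup>2 \<partial>M)"
    by (simp add: S_def)
qed

end

section \<open>Log-likelihood ratio of a pair of densities\<close>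

text \<open>
  \<open>exp (- \<alpha> r)\<close> for \<open>r > - \<infinity>\<close>; at \<open>r = - \<infinity>\<close> the value is the junk \<open>exp 0\<close>.  Almost no sample is
  affected, as \<open>r = - \<infinity>\<close> requires \<open>p \<theta>0\<close> to vanish at an observation.
\<close>

definition exp_neg :: "real \<Rightarrow> ereal \<Rightarrow> ennreal" where
  "exp_neg \<alpha> r = (if r = \<infinity> then 0 else ennreal (exp (- \<alpha> * real_of_ereal r)))"

lemma measurable_exp_neg [measurable]: "exp_neg \<alpha> \<in> borel_measurable borel"
  unfolding exp_neg_def by measurable

text \<open>With all \<open>a i\<close> positive no summand is - \<infinity>, so a single vanishing
  \<open>b i\<close> makes the whole sum \<infinity>.\<close>

lemma sum_ln_ext:
  assumes "finite I" "\<And>i. i \<in> I \<Longrightarrow> 0 < a i" "\<And>i. i \<in> I \<Longrightarrow> 0 \<le> b i"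
  shows "(\<Sum>i\<in>I. ln_ext (ennreal (a i) / ennreal (b i))) =
    (if \<forall>i\<in>I. 0 < b i then ereal (\<Sum>i\<in>I. ln (a i / b i)) else \<infinity>)"
proof -
  have pos: "ln_ext (ennreal (a i) / ennreal (b i)) = ereal (ln (a i / b i))"
    if "i \<in> I" "0 < b i" for i
    using assms(2)[OF that(1)] that(2) by (simp add: divide_ennreal ln_ext_ennreal)
  have zero: "ln_ext (ennreal (a i) / ennreal (b i)) = \<infinity>" if "i \<in> I" "\<not> 0 < b i" for i
    using assms(2)[OF that(1)] that(2)
    by (simp add: ln_ext_def ennreal_divide_eq_0_iff ennreal_eq_0_iff ennreal_zero_divide ennreal_neg
      ennreal_divide_zero)
  show ?thesis
  proof (cases "\<forall>i\<in>I. 0 < b i")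
    case True
    then show ?thesis by (simp add: pos)
  next
    case False
    then show ?thesis
      using assms(1) zero by (auto simp: sum_Pinfty)
  qed
qed

text \<open>If some \<open>b i\<close> is 0, both sides are 0; otherwise this is the exponential of
  a sum.\<close>

lemma exp_neg_sum_ln_ext:
  assumes "finite I" "\<And>i. i \<in> I \<Longrightarrow> 0 < a i" "\<And>i. i \<in> I \<Longrightarrow> 0 \<le> b i" "0 < \<alpha>"
  shows "exp_neg \<alpha> (\<Sum>i\<in>I. ln_ext (ennreal (a i) / ennreal (b i))) =
    (\<Prod>i\<in>I. ennreal ((b i / a i) powr \<alpha>))"
proof (cases "\<forall>i\<in>I. 0 < b i")
  case True
  have "exp (- \<alpha> * (\<Sum>i\<in>I. ln (a i / b i))) = (\<Prod>i\<in>I. exp (\<alpha> * ln (b i / a i)))"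
    unfolding exp_sum[OF assms(1), symmetric] sum_distrib_left
    using assms(2) True by (intro arg_cong[where f=exp] sum.cong) (auto simp: ln_div algebra_simps
      dest: less_imp_neq)
  also have "\<dots> = (\<Prod>i\<in>I. (b i / a i) powr \<alpha>)"
    using True by (intro prod.cong refl) (metis assms(2) divide_pos_pos less_irrefl powr_def)
  finally show ?thesis
    using assms True by (simp add: sum_ln_ext exp_neg_def prod_ennreal)
next
  case False
  then have "\<exists>i\<in>I. b i = 0"
    using assms(3) by force
  then show ?thesis
    using assms by (subst sum_ln_ext) (auto simp: exp_neg_def prod_zero_iff)
qed

text \<open>\<open>f0\<close> is the true density and \<open>f\<close> that of a candidate
  parameter; observations are always drawn from the law with density \<open>f0\<close>.\<close>

locale prob_densities =
  fixes Q :: "'x measure" and f f0 :: "'x \<Rightarrow> real"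
  assumes meas: "f \<in> borel_measurable Q" "f0 \<in> borel_measurable Q"
    and nonneg: "\<And>y. y \<in> space Q \<Longrightarrow> 0 \<le> f y" "\<And>y. y \<in> space Q \<Longrightarrow> 0 \<le> f0 y"
    and prob: "prob_space (density Q f)" "prob_space (density Q f0)"
begin

declare meas [measurable]

interpretation D: prob_space "density Q f" by (rule prob(1))
interpretation D0: prob_space "density Q f0" by (rule prob(2))

lemma nn_integral_prob_density: "(\<integral>\<^sup>+ y. ennreal (f y) \<partial>Q) = 1" "(\<integral>\<^sup>+ y. ennreal (f0 y) \<partial>Q) = 1"
  using D.emeasure_space_1 D0.emeasure_space_1
  by (simp_all add: emeasure_density cong: nn_integral_cong)

lemma AE_density_pos: "AE y in density Q f0. 0 < f0 y"
  by (subst AE_density) auto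

text \<open>The Hellinger integral of order \<alpha>, whose logarithm divided by
  \<open>\<alpha> - 1\<close> is the Renyi divergence.\<close>

definition affinity :: "real \<Rightarrow> ennreal" where
  "affinity \<alpha> = (\<integral>\<^sup>+ y. ennreal (f y powr \<alpha> * f0 y powr (1 - \<alpha>)) \<partial>Q)"

lemma renyi_divergence_eq:
  "renyi_divergence Q \<alpha> (density Q f) (density Q f0) = ereal (1 / (\<alpha> - 1)) * ln_ext (affinity \<alpha>)"
proof -
  \<comment> \<open>\<open>Q\<close> is not assumed sigma-finite; uniqueness of the derivative rests
    on the finiteness of the measure with density \<open>f\<close>.\<close>
  have "AE y in Q. ennreal (f y) = RN_deriv Q (density Q f) y"
    by (intro RN_deriv_unique_sigma_finite) (auto, unfold_locales)
  moreover have "AE y in Q. ennreal (f0 y) = RN_deriv Q (density Q f0) y"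
    by (intro RN_deriv_unique_sigma_finite) (auto, unfold_locales)
  ultimately have "AE y in Q. f y = enn2real (RN_deriv Q (density Q f) y) \<and>
      f0 y = enn2real (RN_deriv Q (density Q f0) y)"
    using AE_space by eventually_elim (metis enn2real_ennreal nonneg)
  then show ?thesis
    unfolding renyi_divergence_def affinity_def
    by (intro arg_cong2[where f="(*)"] arg_cong[where f=ln_ext] nn_integral_cong_AE refl) auto
qed

text \<open>Weighted arithmetic-geometric mean inequality, integrated against
  \<open>Q\<close>.\<close>

lemma affinity_le_1:
  assumes "0 < \<alpha>" "\<alpha> < 1"
  shows "affinity \<alpha> \<le> 1"
proof -
  have "affinity \<alpha> \<le> (\<integral>\<^sup>+ y. ennreal \<alpha> * ennreal (f y) + ennreal (1 - \<alpha>) * ennreal (f0 y) \<partial>Q)"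
    unfolding affinity_def
  proof (intro nn_integral_mono)
    fix y assume y: "y \<in> space Q"
    have "f y powr \<alpha> * f0 y powr (1 - \<alpha>) \<le> \<alpha> * f y + (1 - \<alpha>) * f0 y"
      using assms nonneg[OF y] Youngs_inequality_0[of \<alpha> "1 - \<alpha>" "f y" "f0 y"]
      by (cases "f y = 0 \<or> f0 y = 0") auto
    then show "ennreal (f y powr \<alpha> * f0 y powr (1 - \<alpha>)) \<le>
        ennreal \<alpha> * ennreal (f y) + ennreal (1 - \<alpha>) * ennreal (f0 y)"
      using assms nonneg[OF y] by (auto simp flip: ennreal_mult ennreal_plus intro!: ennreal_leI)
  qed
  also have "\<dots> = 1"
    using assms by (simp add: nn_integral_add nn_integral_cmult nn_integral_prob_density flip: ennreal_plus)
  finally show ?thesis .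
qed

lemma nn_integral_ratio_powr:
  assumes "0 < \<alpha>" "\<alpha> < 1"
  shows "(\<integral>\<^sup>+ y. ennreal ((f y / f0 y) powr \<alpha>) \<partial>density Q f0) = affinity \<alpha>"
  unfolding affinity_def
proof (subst nn_integral_density)
  show "(\<integral>\<^sup>+ y. ennreal (f0 y) * ennreal ((f y / f0 y) powr \<alpha>) \<partial>Q) =
      (\<integral>\<^sup>+ y. ennreal (f y powr \<alpha> * f0 y powr (1 - \<alpha>)) \<partial>Q)"
  proof (intro nn_integral_cong)
    fix y assume "y \<in> space Q"
    then have "f0 y * (f y / f0 y) powr \<alpha> = f y powr \<alpha> * f0 y powr (1 - \<alpha>)"
      using nonneg[of y] by (cases "f0 y = 0") (auto simp: powr_divide powr_diff)
    then show "ennreal (f0 y) * ennreal ((f y / f0 y) powr \<alpha>) =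
        ennreal (f y powr \<alpha> * f0 y powr (1 - \<alpha>))"
      using nonneg \<open>y \<in> space Q\<close> by (simp flip: ennreal_mult)
  qed
qed auto

text \<open>Finiteness gives absolute continuity, so \<open>f\<close> is positive almost surely
  under the true law and \<open>f0 / f\<close> is a version of the Radon-Nikodym derivative by
  \<open>density_divide\<close>.\<close>

lemma KL_ext_density_finite:
  assumes "KL_ext (density Q f0) (density Q f) < \<infinity>"
  shows "AE y in density Q f0. 0 < f y"
    and "integrable (density Q f0) (\<lambda>y. ln (f0 y / f y))"
    and "KL_ext (density Q f0) (density Q f) = ereal (\<integral>y. ln (f0 y / f y) \<partial>density Q f0)"
proof -
  note KL = KL_ext_finite[OF prob(2) D.finite_measure_axioms _ assms, simplified]
  have "AE y in density Q f. 0 < f y"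
    by (subst AE_density) auto
  then show pos: "AE y in density Q f0. 0 < f y"
    by (intro absolutely_continuous_AE[OF _ KL(1)]) auto
  have "density (density Q f) (\<lambda>y. ennreal (f0 y) / ennreal (f y)) = density Q f0"
    using pos by (intro density_divide) auto
  then have "AE y in density Q f. ennreal (f0 y) / ennreal (f y) =
      RN_deriv (density Q f) (density Q f0) y"
    by (intro D.RN_deriv_unique) auto
  then have "AE y in density Q f0. ennreal (f0 y) / ennreal (f y) =
      RN_deriv (density Q f) (density Q f0) y"
    by (intro absolutely_continuous_AE[OF _ KL(1)]) auto
  with pos AE_density_pos have eq: "AE y in density Q f0.
      ln (enn2real (RN_deriv (density Q f) (density Q f0) y)) = ln (f0 y / f y)"
    by eventually_elim (metis divide_ennreal divide_nonneg_pos enn2real_ennreal less_imp_le)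
  show "integrable (density Q f0) (\<lambda>y. ln (f0 y / f y))"
    by (rule Bochner_Integration.integrable_cong_AE_imp[OF KL(2) _ eq]) measurable
  have "(\<integral>y. ln (enn2real (RN_deriv (density Q f) (density Q f0) y)) \<partial>density Q f0) =
      (\<integral>y. ln (f0 y / f y) \<partial>density Q f0)"
    by (rule integral_cong_AE[OF _ _ eq]) measurable
  then show "KL_ext (density Q f0) (density Q f) = ereal (\<integral>y. ln (f0 y / f y) \<partial>density Q f0)"
    using KL(3) by simp
qed

lemma AE_PiM_density_all:
  assumes "finite I" "AE y in density Q f0. \<phi> y"
  shows "AE x in PiM I (\<lambda>_. density Q f0). \<forall>i\<in>I. \<phi> (x i)"
  using assms by (subst AE_finite_all) (auto intro!: AE_PiM_component prob(2))

definition llr :: "'i set \<Rightarrow> ('i \<Rightarrow> 'x) \<Rightarrow> ereal" where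
  "llr I x = (\<Sum>i\<in>I. ln_ext (ennreal (f0 (x i)) / ennreal (f (x i))))"

definition sq_moment :: ennreal where
  "sq_moment = (\<integral>\<^sup>+ y. e2ennreal ((ln_ext (ennreal (f y) / ennreal (f0 y)))\<^sup>2) \<partial>density Q f0)"

section \<open>The log-likelihood ratio of a whole sample\<close>

context
  fixes I :: "'i set"
  assumes I: "finite I" "I \<noteq> {}"
begin

abbreviation "PiI \<equiv> PiM I (\<lambda>_. density Q f0)"

lemma space_PiM_density: "x \<in> space PiI \<Longrightarrow> i \<in> I \<Longrightarrow> x i \<in> space Q"
  by (auto simp: space_PiM PiE_def)

lemma measurable_llr [measurable]: "llr I \<in> borel_measurable PiI"
  unfolding llr_def by measurable

text \<open>Independence factorizes the expectation, and each factor is the Hellinger integral of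
  one observation.\<close>

lemma nn_integral_exp_neg_llr:
  assumes "0 < \<alpha>" "\<alpha> < 1"
  shows "(\<integral>\<^sup>+ x. exp_neg \<alpha> (llr I x) \<partial>PiI) = affinity \<alpha> ^ card I"
proof -
  interpret product_prob_space "\<lambda>_. density Q f0" "I" by unfold_locales
  have "(\<integral>\<^sup>+ x. exp_neg \<alpha> (llr I x) \<partial>PiI) =
      (\<integral>\<^sup>+ x. (\<Prod>i\<in>I. ennreal ((f (x i) / f0 (x i)) powr \<alpha>)) \<partial>PiI)"
  proof (intro nn_integral_cong_AE)
    show "AE x in PiI. exp_neg \<alpha> (llr I x) = (\<Prod>i\<in>I. ennreal ((f (x i) / f0 (x i)) powr \<alpha>))"
      using AE_PiM_density_all[OF I(1) AE_density_pos] AE_space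
    proof eventually_elim
      case (elim x)
      then show ?case
        unfolding llr_def using assms(1)
        using I(1) elim by (intro exp_neg_sum_ln_ext) (auto intro: nonneg space_PiM_density)
    qed
  qed
  also have "\<dots> = (\<Prod>i\<in>I. affinity \<alpha>)"
    using assms by (subst product_nn_integral_prod) (auto simp: nn_integral_ratio_powr I(1))
  finally show ?thesis by simp
qed

lemma AE_llr_eq:
  assumes "AE y in density Q f0. 0 < f y"
  shows "AE x in PiI. llr I x = ereal (\<Sum>i\<in>I. ln (f0 (x i) / f (x i)))"
  using AE_PiM_density_all[OF I(1) AE_density_pos]
    AE_PiM_density_all[OF I(1) assms]
  unfolding llr_def by eventually_elim (subst sum_ln_ext[OF I(1)], auto intro: less_imp_le)

text \<open>Equality holds for a finite divergence. For an infinite one the Bochner integral may be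
  a default value, and the bound is trivial.\<close>

lemma mean_llr_le_KL:
  "ennreal ((\<integral>x. real_of_ereal (llr I x) \<partial>PiI) / card I) \<le> e2ennreal (KL_ext (density Q f0) (density Q f))"
proof (cases "KL_ext (density Q f0) (density Q f) < \<infinity>")
  case True
  note KL = KL_ext_density_finite[OF True]
  have "(\<integral>x. real_of_ereal (llr I x) \<partial>PiI) = (\<integral>x. (\<Sum>i\<in>I. ln (f0 (x i) / f (x i))) \<partial>PiI)"
    using AE_llr_eq[OF KL(1)] by (intro integral_cong_AE) (auto, measurable)
  also have "\<dots> = card I * (\<integral>y. ln (f0 y / f y) \<partial>density Q f0)"
    using integral_PiM_sum(2)[OF prob(2) I(1) KL(2)] by simp
  finally show ?thesis
    using I by (simp add: KL(3))
qed (simp add: less_top[symmetric])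

lemma ext_integral_sq_llr:
  assumes "i \<in> I"
  shows "ext_integral PiI (\<lambda>x. (ln_ext (ennreal (f (x i)) / ennreal (f0 (x i))))\<^sup>2) = enn2ereal sq_moment"
proof -
  interpret product_prob_space "\<lambda>_. density Q f0" "I" by unfold_locales
  have "sq_moment = (\<integral>\<^sup>+ y. e2ennreal ((ln_ext (ennreal (f y) / ennreal (f0 y)))\<^sup>2)
      \<partial>distr PiI (density Q f0) (\<lambda>x. x i))"
    using assms by (subst PiM_component) (auto simp: sq_moment_def)
  also have "\<dots> = (\<integral>\<^sup>+ x. e2ennreal ((ln_ext (ennreal (f (x i)) / ennreal (f0 (x i))))\<^sup>2) \<partial>PiI)"
    using assms by (subst nn_integral_distr) (auto simp: power2_eq_square)
  finally have "sq_moment = \<dots>" .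
  moreover have "0 \<le> a\<^sup>2" for a :: ereal
    by (cases a) (auto simp: power2_eq_square)
  ultimately show ?thesis
    by (simp add: ext_integral_nonneg)
qed

text \<open>Where \<open>f\<close> vanishes and \<open>f0\<close> does not, the squared logarithm is
  \<infinity>; a finite integral therefore excludes such points almost surely.\<close>

lemma sq_moment_finite:
  assumes "sq_moment < \<infinity>"
  shows "AE y in density Q f0. 0 < f y"
    and "integrable (density Q f0) (\<lambda>y. (ln (f0 y / f y))\<^sup>2)"
    and "ennreal (\<integral>y. (ln (f0 y / f y))\<^sup>2 \<partial>density Q f0) = sq_moment"
proof -
  have "AE y in density Q f0. e2ennreal ((ln_ext (ennreal (f y) / ennreal (f0 y)))\<^sup>2) \<noteq> \<infinity>"
    using assms unfolding sq_moment_def power2_eq_square by (intro nn_integral_PInf_AE) auto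
  then show pos: "AE y in density Q f0. 0 < f y"
    using AE_space by eventually_elim
      (use nonneg in \<open>force simp: power2_eq_square ln_ext_def less_le\<close>)
  have eq: "(\<integral>\<^sup>+ y. ennreal ((ln (f0 y / f y))\<^sup>2) \<partial>density Q f0) = sq_moment"
    unfolding sq_moment_def
  proof (intro nn_integral_cong_AE)
    show "AE y in density Q f0. ennreal ((ln (f0 y / f y))\<^sup>2) =
        e2ennreal ((ln_ext (ennreal (f y) / ennreal (f0 y)))\<^sup>2)"
      using pos AE_density_pos by eventually_elim
        (simp add: divide_ennreal ln_ext_ennreal ln_div power2_commute)
  qed
  with assms show int: "integrable (density Q f0) (\<lambda>y. (ln (f0 y / f y))\<^sup>2)"
    by (intro integrableI_nonneg) auto
  show "ennreal (\<integral>y. (ln (f0 y / f y))\<^sup>2 \<partial>density Q f0) = sq_moment"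
    using eq nn_integral_eq_integral[OF int] by simp
qed

lemma moments_llr_le:
  shows "(\<integral>\<^sup>+ x. e2ennreal ((llr I x)\<^sup>2) \<partial>PiI) \<le> ennreal ((real (card I))\<^sup>2) * sq_moment" (is ?second)
    and "(\<integral>\<^sup>+ x. ennreal ((real_of_ereal (llr I x) - (\<integral>x. real_of_ereal (llr I x) \<partial>PiI))\<^sup>2) \<partial>PiI)
      \<le> ennreal (real (card I)) * sq_moment" (is ?variance)
proof -
  have "?second \<and> ?variance"
  proof (cases "sq_moment < \<infinity>")
    case True
    note sq = sq_moment_finite[OF True]
    let ?l = "\<lambda>y. ln (f0 y / f y)"
    let ?S = "\<lambda>x. \<Sum>i\<in>I. ?l (x i)"
    let ?\<mu> = "\<integral>y. ?l y \<partial>density Q f0"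
    have l: "integrable (density Q f0) ?l"
      by (rule D0.square_integrable_imp_integrable[OF _ sq(2)]) measurable
    have llr: "AE x in PiI. llr I x = ereal (?S x)"
      using AE_llr_eq[OF sq(1)] .
    have [measurable]: "?S \<in> borel_measurable PiI"
      by measurable
    have mean: "(\<integral>x. real_of_ereal (llr I x) \<partial>PiI) = card I * ?\<mu>"
    proof -
      have "(\<integral>x. real_of_ereal (llr I x) \<partial>PiI) = (\<integral>x. ?S x \<partial>PiI)"
        using llr by (intro integral_cong_AE) auto
      also note integral_PiM_sum(2)[OF prob(2) I(1) l]
      finally show ?thesis .
    qed
    have "(\<integral>\<^sup>+ x. e2ennreal ((llr I x)\<^sup>2) \<partial>PiI) = (\<integral>\<^sup>+ x. ennreal ((?S x)\<^sup>2) \<partial>PiI)"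
      by (intro nn_integral_cong_AE eventually_mono[OF llr]) (simp only: ereal_power e2ennreal_ereal)
    also have "\<dots> = ennreal (\<integral>x. (?S x)\<^sup>2 \<partial>PiI)"
      using second_moment_PiM_sum(1)[OF prob(2) I(1) l sq(2)]
      by (rule nn_integral_eq_integral) simp
    also have "\<dots> \<le> ennreal ((real (card I))\<^sup>2 * (\<integral>y. (?l y)\<^sup>2 \<partial>density Q f0))"
      by (intro ennreal_leI second_moment_PiM_sum(2)[OF prob(2) I(1) l sq(2)])
    also have "\<dots> = ennreal ((real (card I))\<^sup>2) * sq_moment"
      unfolding sq(3)[symmetric] by (rule ennreal_mult) auto
    finally have second: ?second .
    have "(\<integral>\<^sup>+ x. ennreal ((real_of_ereal (llr I x) - (\<integral>x. real_of_ereal (llr I x) \<partial>PiI))\<^sup>2) \<partial>PiI)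
        = (\<integral>\<^sup>+ x. ennreal ((?S x - card I * ?\<mu>)\<^sup>2) \<partial>PiI)"
      unfolding mean
      by (intro nn_integral_cong_AE eventually_mono[OF llr]) (simp only: real_of_ereal.simps)
    also have "\<dots> = ennreal (\<integral>x. (?S x - card I * ?\<mu>)\<^sup>2 \<partial>PiI)"
      using variance_PiM_sum(1)[OF prob(2) I(1) l sq(2)] by (rule nn_integral_eq_integral) simp
    also have "\<dots> \<le> ennreal (card I * (\<integral>y. (?l y)\<^sup>2 \<partial>density Q f0))"
      by (intro ennreal_leI variance_PiM_sum_le[OF prob(2) I(1) l sq(2)])
    also have "\<dots> = ennreal (real (card I)) * sq_moment"
      unfolding sq(3)[symmetric] by (rule ennreal_mult) auto
    finally show ?thesis
      using second by blast
  next
    case False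
    then have "sq_moment = \<infinity>"
      by (simp add: less_top[symmetric])
    \<comment> \<open>\<open>I\<close> is nonempty, so both factors are positive and both right-hand
      sides are \<infinity>.\<close>
    with I show ?thesis
      by (simp add: ennreal_mult_top)
  qed
  then show ?second ?variance by blast+
qed

end

end

section \<open>Tempered posteriors as Gibbs measures\<close>

lemma ennreal_divide_pos: "0 < a \<Longrightarrow> b \<noteq> \<infinity> \<Longrightarrow> 0 < a / b" for a b :: ennreal
  by (simp add: ennreal_divide_eq_0_iff zero_less_iff_neq_zero)

lemma exp_neg_less_top: "exp_neg \<alpha> r < \<infinity>"
  by (simp add: exp_neg_def)

lemma exp_neg_pos: "r < \<infinity> \<Longrightarrow> 0 < exp_neg \<alpha> r"
  by (auto simp: exp_neg_def ennreal_eq_0_iff zero_less_iff_neq_zero)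

text \<open>One sample is fixed and \<open>r\<close> is its log-likelihood ratio as a function of
  the parameter. Positivity and finiteness of the normalizer make the Gibbs measure a
  probability.\<close>

locale gibbs_measure = prob_space \<pi> for \<pi> :: "'t measure" +
  fixes r :: "'t \<Rightarrow> ereal" and \<alpha> :: real
  assumes r_measurable: "r \<in> borel_measurable \<pi>"
    and r_MInf: "\<And>\<theta>. \<theta> \<in> space \<pi> \<Longrightarrow> r \<theta> \<noteq> - \<infinity>"
    and \<alpha>_pos: "0 < \<alpha>"
    and Z_pos: "0 < (\<integral>\<^sup>+ \<theta>. exp_neg \<alpha> (r \<theta>) \<partial>\<pi>)"
    and Z_finite: "(\<integral>\<^sup>+ \<theta>. exp_neg \<alpha> (r \<theta>) \<partial>\<pi>) < \<infinity>"
begin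

declare r_measurable [measurable]

definition Z :: real where
  "Z = enn2real (\<integral>\<^sup>+ \<theta>. exp_neg \<alpha> (r \<theta>) \<partial>\<pi>)"

lemma Z: "0 < Z" "(\<integral>\<^sup>+ \<theta>. exp_neg \<alpha> (r \<theta>) \<partial>\<pi>) = ennreal Z"
  using Z_pos Z_finite by (auto simp: Z_def enn2real_positive_iff)

definition gibbs :: "'t measure" where
  "gibbs = density \<pi> (\<lambda>\<theta>. exp_neg \<alpha> (r \<theta>) / ennreal Z)"

lemma sets_gibbs [simp, measurable_cong]: "sets gibbs = sets \<pi>"
  by (simp add: gibbs_def)

lemma prob_space_gibbs: "prob_space gibbs"
proof
  show "emeasure gibbs (space gibbs) = 1"
    using Z by (simp add: gibbs_def emeasure_density nn_integral_divide cong: nn_integral_cong)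
qed

interpretation gibbs: prob_space gibbs by (rule prob_space_gibbs)

text \<open>The log-derivative with respect to \<open>gibbs\<close> is the one with respect to \<pi>
  plus \<open>\<alpha> * r + ln Z\<close>. Integrated, this identifies the two variational
  objectives up to the constant \<open>ln Z\<close>.\<close>

lemma KL_ext_gibbs:
  assumes \<rho>: "prob_space \<rho>" "sets \<rho> = sets \<pi>"
    and KL: "KL_ext \<rho> \<pi> < \<infinity>" and r: "ext_integral \<rho> r < \<infinity>"
  shows "integrable \<rho> (\<lambda>\<theta>. real_of_ereal (r \<theta>))"
    and "AE \<theta> in \<rho>. \<bar>r \<theta>\<bar> \<noteq> \<infinity>"
    and "KL_ext \<rho> gibbs =
      ereal \<alpha> * ereal (\<integral>\<theta>. real_of_ereal (r \<theta>) \<partial>\<rho>) + KL_ext \<rho> \<pi> + ereal (ln Z)"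
proof -
  interpret \<rho>: prob_space \<rho> by (rule \<rho>(1))
  have [measurable_cong]: "sets \<rho> = sets \<pi>" by (rule \<rho>(2))
  have space: "space \<rho> = space \<pi>"
    using \<rho>(2) by (rule sets_eq_imp_space_eq)
  note KL_\<pi> = KL_ext_finite[OF \<rho>(1) finite_measure_axioms \<rho>(2) KL]
  define \<phi> where "\<phi> \<theta> = exp_neg \<alpha> (r \<theta>) / ennreal Z" for \<theta>
  have [measurable]: "\<phi> \<in> borel_measurable \<pi>"
    unfolding \<phi>_def by measurable
  have gibbs_eq: "gibbs = density \<pi> \<phi>"
    by (simp add: gibbs_def \<phi>_def[abs_def])
  have r_pos: "(\<integral>\<^sup>+ \<theta>. e2ennreal (r \<theta>) \<partial>\<rho>) < \<infinity>"
    using r by (rule ext_integral_pos_part_finite)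
  then have "AE \<theta> in \<rho>. e2ennreal (r \<theta>) \<noteq> \<infinity>"
    by (intro nn_integral_PInf_AE) auto
  then show r_real: "AE \<theta> in \<rho>. \<bar>r \<theta>\<bar> \<noteq> \<infinity>"
    using AE_space
  proof eventually_elim
    case (elim \<theta>)
    then show ?case
      using r_MInf[of \<theta>] by (cases "r \<theta>") (auto simp: space)
  qed
  have dens: "density \<pi> (RN_deriv \<pi> \<rho>) = \<rho>"
    using KL_\<pi>(1) \<rho>(2) by (rule density_RN_deriv)
  have \<phi>_pos: "AE \<theta> in \<rho>. 0 < \<phi> \<theta>"
    using r_real
  proof eventually_elim
    case (elim \<theta>)
    then have "0 < exp_neg \<alpha> (r \<theta>)"
      by (intro exp_neg_pos) auto
    then show ?case
      unfolding \<phi>_def by (rule ennreal_divide_pos) simp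
  qed
  then have \<phi>_pos': "AE \<theta> in density \<pi> (RN_deriv \<pi> \<rho>). 0 < \<phi> \<theta>"
    unfolding dens .
  have \<phi>_fin: "\<phi> \<theta> < \<infinity>" for \<theta>
    using Z(1) by (simp add: \<phi>_def exp_neg_def divide_ennreal)
  have dens': "density gibbs (\<lambda>\<theta>. RN_deriv \<pi> \<rho> \<theta> / \<phi> \<theta>) = \<rho>"
    unfolding gibbs_eq
    using density_divide[OF borel_measurable_RN_deriv
      \<open>\<phi> \<in> borel_measurable \<pi>\<close> \<phi>_pos' AE_I2[OF \<phi>_fin]]
    by (simp only: dens)
  then have ac: "absolutely_continuous gibbs \<rho>"
    by (metis absolutely_continuousI_density borel_measurable_RN_deriv
      \<open>\<phi> \<in> borel_measurable \<pi>\<close> borel_measurable_divide_ennreal measurable_cong_sets sets_gibbs)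
  have "AE \<theta> in gibbs. RN_deriv \<pi> \<rho> \<theta> / \<phi> \<theta> = RN_deriv gibbs \<rho> \<theta>"
    using dens' by (intro gibbs.RN_deriv_unique) auto
  then have RN_eq: "AE \<theta> in \<rho>. RN_deriv \<pi> \<rho> \<theta> / \<phi> \<theta> = RN_deriv gibbs \<rho> \<theta>"
    using \<rho>(2) by (intro absolutely_continuous_AE[OF _ ac]) auto
  let ?g = "\<lambda>\<theta>. ln (enn2real (RN_deriv gibbs \<rho> \<theta>))"
  let ?f = "\<lambda>\<theta>. ln (enn2real (RN_deriv \<pi> \<rho> \<theta>))"
  let ?r = "\<lambda>\<theta>. real_of_ereal (r \<theta>)"
  have g_eq: "AE \<theta> in \<rho>. ?g \<theta> = ?f \<theta> + \<alpha> * ?r \<theta> + ln Z"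
    using RN_eq r_real RN_deriv_pos_finite[OF \<rho>(1) finite_measure_axioms \<rho>(2) KL_\<pi>(1)]
  proof eventually_elim
    case (elim \<theta>)
    obtain a where a: "r \<theta> = ereal a"
      using elim(2) by auto
    obtain t where t: "RN_deriv \<pi> \<rho> \<theta> = ennreal t" "0 < t"
      using elim(3) by (cases "RN_deriv \<pi> \<rho> \<theta>") auto
    have "RN_deriv gibbs \<rho> \<theta> = ennreal (t / (exp (- \<alpha> * a) / Z))"
      unfolding elim(1)[symmetric] using t Z(1)
      by (simp add: \<phi>_def a exp_neg_def divide_ennreal)
    then show ?case
      using t Z(1) by (simp add: a ln_div ln_mult)
  qed
  \<comment> \<open>The positive part is dominated by the positive parts of the three terms; the
    negative part of a log-derivative is integrable in any case.\<close>
  have "integrable \<rho> ?g"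
  proof -
    have "(\<integral>\<^sup>+ \<theta>. ennreal (?g \<theta>) \<partial>\<rho>) \<le>
        (\<integral>\<^sup>+ \<theta>. ennreal (?f \<theta>) + ennreal \<alpha> * e2ennreal (r \<theta>) + ennreal (ln Z) \<partial>\<rho>)"
    proof (intro nn_integral_mono_AE)
      show "AE \<theta> in \<rho>. ennreal (?g \<theta>) \<le> ennreal (?f \<theta>) + ennreal \<alpha> * e2ennreal (r \<theta>) + ennreal (ln Z)"
        using g_eq r_real
      proof eventually_elim
        case (elim \<theta>)
        have "ennreal (?g \<theta>) \<le> ennreal (max 0 (?f \<theta>) + \<alpha> * max 0 (?r \<theta>) + max 0 (ln Z))"
          unfolding elim(1) using \<alpha>_pos by (intro ennreal_leI add_mono mult_left_mono) auto
        also have "\<dots> = ennreal (?f \<theta>) + ennreal \<alpha> * ennreal (?r \<theta>) + ennreal (ln Z)"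
        proof -
          have "ennreal (max 0 u) = ennreal u" for u
            by (cases "0 \<le> u") (auto simp: ennreal_neg)
          then show ?thesis
            using \<alpha>_pos by (simp add: ennreal_plus ennreal_mult)
        qed
        also have "ennreal (?r \<theta>) = e2ennreal (r \<theta>)"
          using elim(2) by auto
        finally show ?case .
      qed
    qed
    also have "\<dots> = (\<integral>\<^sup>+ \<theta>. ennreal (?f \<theta>) \<partial>\<rho>) + ennreal \<alpha> * (\<integral>\<^sup>+ \<theta>. e2ennreal (r \<theta>) \<partial>\<rho>) + ennreal (ln Z)"
      by (simp add: nn_integral_add nn_integral_cmult \<rho>.emeasure_space_1)
    also have "\<dots> < \<infinity>"
      using r_pos KL_\<pi>(2) by (auto simp: real_integrable_def ennreal_mult_less_top less_top)
    finally show ?thesis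
      using nn_integral_neg_ln_RN_deriv[OF \<rho>(1) gibbs.finite_measure_axioms _ ac] \<rho>(2)
      by (simp add: real_integrable_def less_top)
  qed
  \<comment> \<open>Solving for \<open>r\<close> also controls its negative part, on which
    \<open>ext_integral \<rho> r < \<infinity>\<close> gives no direct information.\<close>
  have "integrable \<rho> (\<lambda>\<theta>. (?g \<theta> - ?f \<theta> - ln Z) / \<alpha>)"
    using \<open>integrable \<rho> ?g\<close> KL_\<pi>(2) by auto
  then show int_r: "integrable \<rho> ?r"
    by (rule Bochner_Integration.integrable_cong_AE_imp)
      (use g_eq \<alpha>_pos in \<open>auto elim!: eventually_mono\<close>)
  have RN_fin: "AE \<theta> in \<rho>. ln_ext (RN_deriv gibbs \<rho> \<theta>) = ereal (?g \<theta>)"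
    by (rule eventually_mono[OF RN_deriv_pos_finite[OF \<rho>(1) gibbs.finite_measure_axioms _ ac]])
      (auto simp: \<rho>(2) ln_ext_def)
  have "(\<integral>\<theta>. ?g \<theta> \<partial>\<rho>) = (\<integral>\<theta>. ?f \<theta> + \<alpha> * ?r \<theta> + ln Z \<partial>\<rho>)"
    using g_eq by (intro integral_cong_AE) auto
  also have "\<dots> = (\<integral>\<theta>. ?f \<theta> \<partial>\<rho>) + \<alpha> * (\<integral>\<theta>. ?r \<theta> \<partial>\<rho>) + ln Z"
    using int_r KL_\<pi>(2) by (simp add: \<rho>.prob_space)
  finally show "KL_ext \<rho> gibbs =
      ereal \<alpha> * ereal (\<integral>\<theta>. ?r \<theta> \<partial>\<rho>) + KL_ext \<rho> \<pi> + ereal (ln Z)"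
    unfolding KL_\<pi>(3) using ac ext_integral_eq_integral[OF \<open>integrable \<rho> ?g\<close> RN_fin]
    by (simp add: KL_ext_def)
qed

text \<open>Donsker-Varadhan with reference measure \<open>gibbs\<close> and
  \<open>d = - ln G\<close>: normalization turns the exponential moment bound \<open>C\<close> into
  \<open>C / Z\<close>. The same bound forces \<open>G > 0\<close> wherever the Gibbs density is
  positive, hence almost everywhere under \<rho>.\<close>

lemma integral_le_KL_ext_gibbs:
  assumes \<rho>: "prob_space \<rho>" "sets \<rho> = sets \<pi>" and KL: "KL_ext \<rho> gibbs < \<infinity>"
    and [measurable]: "G \<in> borel_measurable \<pi>" and G: "\<And>\<theta>. G \<theta> \<le> 1"
    and C: "0 < C" "(\<integral>\<^sup>+ \<theta>. exp_neg \<alpha> (r \<theta>) / G \<theta> \<partial>\<pi>) \<le> ennreal C"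
  shows "AE \<theta> in \<rho>. 0 < G \<theta>"
    and "integrable \<rho> (\<lambda>\<theta>. - ln (enn2real (G \<theta>)))"
    and "ereal (\<integral>\<theta>. - ln (enn2real (G \<theta>)) \<partial>\<rho>) \<le> KL_ext \<rho> gibbs + ereal (ln C - ln Z)"
proof -
  note ac = KL_ext_finite(1)[OF \<rho>(1) gibbs.finite_measure_axioms _ KL]
  have "AE \<theta> in \<pi>. exp_neg \<alpha> (r \<theta>) / G \<theta> \<noteq> \<infinity>"
    using C(2) by (intro nn_integral_PInf_AE) (auto simp: less_top[symmetric] top_unique)
  then have zero: "AE \<theta> in \<pi>. 0 < exp_neg \<alpha> (r \<theta>) \<longrightarrow> 0 < G \<theta>"
    by eventually_elim (auto simp: zero_less_iff_neq_zero ennreal_divide_eq_top_iff)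
  have "AE \<theta> in gibbs. 0 < G \<theta>"
    unfolding gibbs_def using zero
    by (subst AE_density) (auto elim!: eventually_mono simp: zero_less_iff_neq_zero ennreal_divide_eq_0_iff)
  then show "AE \<theta> in \<rho>. 0 < G \<theta>"
    using \<rho>(2) ac by (intro absolutely_continuous_AE[of \<rho> gibbs]) auto
  let ?d = "\<lambda>\<theta>. - ln (enn2real (G \<theta>))"
  have G': "0 \<le> enn2real (G \<theta>)" "enn2real (G \<theta>) \<le> 1" for \<theta>
    using G[of \<theta>] by (auto simp: enn2real_leI)
  \<comment> \<open>\<open>G \<le> 1\<close> gives the sign; where \<open>G = 0\<close>, the default
    \<open>ln 0 = 0\<close> keeps it.\<close>
  have d: "0 \<le> ?d \<theta>" for \<theta>
  proof (cases "enn2real (G \<theta>) = 0")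
    case False
    then show ?thesis
      using G'[of \<theta>] by (simp add: less_le)
  qed simp
  have "(\<integral>\<^sup>+ \<theta>. ennreal (exp (?d \<theta>)) \<partial>gibbs) =
      (\<integral>\<^sup>+ \<theta>. exp_neg \<alpha> (r \<theta>) / ennreal Z * ennreal (exp (?d \<theta>)) \<partial>\<pi>)"
    unfolding gibbs_def by (subst nn_integral_density) auto
  also have "\<dots> \<le> (\<integral>\<^sup>+ \<theta>. exp_neg \<alpha> (r \<theta>) / G \<theta> / ennreal Z \<partial>\<pi>)"
  proof (intro nn_integral_mono_AE)
    show "AE \<theta> in \<pi>. exp_neg \<alpha> (r \<theta>) / ennreal Z * ennreal (exp (?d \<theta>)) \<le>
        exp_neg \<alpha> (r \<theta>) / G \<theta> / ennreal Z"
      using zero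
    proof eventually_elim
      case (elim \<theta>)
      show ?case
      proof (cases "exp_neg \<alpha> (r \<theta>) = 0")
        case False
        with elim have "0 < G \<theta>"
          by (auto simp: zero_less_iff_neq_zero)
        then obtain g where g: "G \<theta> = ennreal g" "0 < g"
          using G[of \<theta>] by (cases "G \<theta>") (auto simp: top_unique)
        obtain u where u: "exp_neg \<alpha> (r \<theta>) = ennreal u" "0 \<le> u"
          using exp_neg_less_top[of \<alpha> "r \<theta>"] by (cases "exp_neg \<alpha> (r \<theta>)") auto
        show ?thesis
          using u g Z(1) by (simp add: divide_ennreal exp_minus field_simps flip: ennreal_mult)
      qed simp
    qed
  qed
  also have "\<dots> = (\<integral>\<^sup>+ \<theta>. exp_neg \<alpha> (r \<theta>) / G \<theta> \<partial>\<pi>) / ennreal Z"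
    by (intro nn_integral_divide) auto
  also have "\<dots> \<le> ennreal C / ennreal Z"
    by (intro divide_right_mono_ennreal C)
  also have "\<dots> = ennreal (C / Z)"
    using C Z by (simp add: divide_ennreal)
  finally have le: "(\<integral>\<^sup>+ \<theta>. ennreal (exp (?d \<theta>)) \<partial>gibbs) \<le> ennreal (C / Z)" .
  note DV = Donsker_Varadhan[OF \<rho>(1) gibbs.finite_measure_axioms _ KL _ d _ le]
  show "integrable \<rho> ?d"
    using DV(1) \<rho>(2) C(1) Z(1) by auto
  show "ereal (\<integral>\<theta>. ?d \<theta> \<partial>\<rho>) \<le> KL_ext \<rho> gibbs + ereal (ln C - ln Z)"
    using DV(2) \<rho>(2) C(1) Z(1) by (auto simp: ln_div)
qed

end

section \<open>The two concentration events\<close>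

text \<open>Jensen's inequality for the square, from nonnegativity of the variance; without square
  integrability the right-hand side is infinite.\<close>

lemma (in prob_space) square_integral_le_nn_integral:
  fixes Y :: "'a \<Rightarrow> real"
  assumes "integrable M Y"
  shows "ennreal ((\<integral>x. Y x \<partial>M)\<^sup>2) \<le> (\<integral>\<^sup>+ x. ennreal ((Y x)\<^sup>2) \<partial>M)"
proof (cases "(\<integral>\<^sup>+ x. ennreal ((Y x)\<^sup>2) \<partial>M) < \<infinity>")
  case True
  have [measurable]: "Y \<in> borel_measurable M"
    using assms by auto
  have int: "integrable M (\<lambda>x. (Y x)\<^sup>2)"
    using True by (intro integrableI_nonneg) auto
  have "(\<integral>x. Y x \<partial>M)\<^sup>2 \<le> (\<integral>x. (Y x)\<^sup>2 \<partial>M)"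
    using variance_eq[OF assms int] variance_positive[of Y] by simp
  then show ?thesis
    by (subst nn_integral_eq_integral[OF int]) (auto intro: ennreal_leI)
qed (simp add: less_top[symmetric])

lemma enn2ereal_le_ereal: "enn2ereal u \<le> ereal a \<Longrightarrow> u \<le> ennreal a"
  using e2ennreal_mono[of "enn2ereal u" "ereal a"] by simp

locale tempered_model =
  fixes T :: "'t measure" and Q :: "'x measure" and p :: "'t \<Rightarrow> 'x \<Rightarrow> real"
    and P :: "'t \<Rightarrow> 'x measure" and \<theta>0 :: 't and n :: nat and \<alpha> :: real
  assumes prob: "\<And>\<theta>. \<theta> \<in> space T \<Longrightarrow> prob_space (P \<theta>)"
    and p_measurable: "\<And>\<theta>. \<theta> \<in> space T \<Longrightarrow> p \<theta> \<in> borel_measurable Q"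
    and p_nonneg: "\<And>\<theta> y. \<theta> \<in> space T \<Longrightarrow> y \<in> space Q \<Longrightarrow> 0 \<le> p \<theta> y"
    and P_eq: "\<And>\<theta>. \<theta> \<in> space T \<Longrightarrow> P \<theta> = density Q (\<lambda>y. ennreal (p \<theta> y))"
    and \<theta>0: "\<theta>0 \<in> space T" and n: "1 \<le> n"
    and joint_measurable: "(\<lambda>(x, \<theta>). log_lik_ratio p n \<theta> \<theta>0 x)
      \<in> borel_measurable (PiM {1..n} (\<lambda>_. P \<theta>0) \<Otimes>\<^sub>M T)"
    and \<alpha>: "0 < \<alpha>" "\<alpha> < 1"
begin

definition Pn :: "(nat \<Rightarrow> 'x) measure" where
  "Pn = PiM {1..n} (\<lambda>_. P \<theta>0)"

abbreviation "r x \<theta> \<equiv> log_lik_ratio p n \<theta> \<theta>0 x"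

sublocale Pn: prob_space Pn
  unfolding Pn_def by (intro prob_space_PiM prob \<theta>0)

lemma Pn_eq: "Pn = PiM {1..n} (\<lambda>_. density Q (\<lambda>y. ennreal (p \<theta>0 y)))"
  by (simp add: Pn_def P_eq[OF \<theta>0])

lemma densities: "\<theta> \<in> space T \<Longrightarrow> prob_densities Q (p \<theta>) (p \<theta>0)"
  using prob P_eq p_measurable p_nonneg \<theta>0 by (simp add: prob_densities_def)

lemma r_eq_llr: "r x \<theta> = prob_densities.llr (p \<theta>) (p \<theta>0) {1..n} x" if "\<theta> \<in> space T"
  unfolding log_lik_ratio_def prob_densities.llr_def[OF densities[OF that]] ..

lemma r_measurable [measurable]:
  assumes [measurable_cong]: "sets \<rho> = sets T"
  shows "(\<lambda>(x, \<theta>). r x \<theta>) \<in> borel_measurable (Pn \<Otimes>\<^sub>M \<rho>)"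
  using joint_measurable[folded Pn_def] by measurable

lemma r_section_measurable:
  shows "\<theta> \<in> space T \<Longrightarrow> (\<lambda>x. r x \<theta>) \<in> borel_measurable Pn"
    and "x \<in> space Pn \<Longrightarrow> (\<lambda>\<theta>. r x \<theta>) \<in> borel_measurable T"
  using joint_measurable[folded Pn_def] by (auto dest: measurable_Pair1' measurable_compose[rotated])

text \<open>The minimum with \<open>1\<close> only matters for junk parameters outside \<open>space T\<close>.\<close>

definition G :: "'t \<Rightarrow> ennreal" where
  "G \<theta> = min 1 (\<integral>\<^sup>+ x. exp_neg \<alpha> (r x \<theta>) \<partial>Pn)"

lemma G_eq:
  assumes "\<theta> \<in> space T"
  shows "(\<integral>\<^sup>+ x. exp_neg \<alpha> (r x \<theta>) \<partial>Pn) = G \<theta>"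
    and "G \<theta> = prob_densities.affinity Q (p \<theta>) (p \<theta>0) \<alpha> ^ n"
proof -
  interpret prob_densities Q "p \<theta>" "p \<theta>0"
    using assms by (rule densities)
  have "(\<integral>\<^sup>+ x. exp_neg \<alpha> (r x \<theta>) \<partial>Pn) = affinity \<alpha> ^ n"
    unfolding r_eq_llr[OF assms] Pn_eq
    using n by (subst nn_integral_exp_neg_llr) (auto simp: \<alpha>)
  moreover have "affinity \<alpha> ^ n \<le> 1"
    using power_mono[OF affinity_le_1[OF \<alpha>], of n] by simp
  ultimately show "(\<integral>\<^sup>+ x. exp_neg \<alpha> (r x \<theta>) \<partial>Pn) = G \<theta>" "G \<theta> = affinity \<alpha> ^ n"
    by (auto simp: G_def min_def)
qed

text \<open>Joint measurability of \<open>r\<close> passes to the integral over the sample. This is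
  how the Renyi divergence becomes tractable as a function of \<theta>.\<close>

lemma G_measurable:
  assumes [measurable_cong]: "sets \<rho> = sets T"
  shows "G \<in> borel_measurable \<rho>"
proof -
  have [measurable]: "(\<lambda>(\<theta>, x). r x \<theta>) \<in> borel_measurable (\<rho> \<Otimes>\<^sub>M Pn)"
    using measurable_pair_swap[OF r_measurable[OF assms]] by (simp add: split_beta')
  show ?thesis
    unfolding G_def by measurable
qed

text \<open>\<open>G \<theta>\<close> is the \<open>n\<close>-th power of the Hellinger integral, so
  its logarithm carries the factor \<open>n\<close>, and the sign of \<open>\<alpha> - 1\<close> is
  absorbed.\<close>

lemma renyi_divergence_eq_G:
  assumes "\<theta> \<in> space T" "0 < G \<theta>"
  shows "renyi_divergence Q \<alpha> (P \<theta>) (P \<theta>0) = ereal (- ln (enn2real (G \<theta>)) / (n * (1 - \<alpha>)))"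
proof -
  interpret prob_densities Q "p \<theta>" "p \<theta>0"
    using assms(1) by (rule densities)
  obtain h where h: "affinity \<alpha> = ennreal h" "0 \<le> h"
    using affinity_le_1[OF \<alpha>] by (cases "affinity \<alpha>") (auto simp: top_unique)
  have G: "G \<theta> = ennreal (h ^ n)"
    using G_eq(2)[OF assms(1)] h by (simp add: ennreal_power)
  then have "0 < h"
    using assms(2) h n by (cases "h = 0") (auto simp: zero_power)
  then show ?thesis
    using n \<alpha> unfolding P_eq[OF assms(1)] P_eq[OF \<theta>0] renyi_divergence_eq h G
    by (simp add: ln_ext_ennreal ln_realpow) (simp add: field_simps)
qed

text \<open>The integral is \<open>G \<theta> / G \<theta>\<close>, which is 1, or 0 when
  \<open>G \<theta> = 0\<close>; singular parameters are thus covered.\<close>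

lemma nn_integral_exp_neg_divide_G_le:
  assumes "\<theta> \<in> space T"
  shows "(\<integral>\<^sup>+ x. exp_neg \<alpha> (r x \<theta>) / G \<theta> \<partial>Pn) \<le> 1"
proof -
  note [measurable] = r_section_measurable(1)[OF assms]
  have "(\<integral>\<^sup>+ x. exp_neg \<alpha> (r x \<theta>) / G \<theta> \<partial>Pn) = G \<theta> / G \<theta>"
    using G_eq(1)[OF assms] by (subst nn_integral_divide) auto
  also have "\<dots> \<le> 1"
    by (cases "G \<theta> = 0 \<or> G \<theta> = \<infinity>") (auto simp: ennreal_divide_self less_top)
  finally show ?thesis .
qed

lemma prob_exp_moment_le:
  assumes \<pi>: "\<pi> \<in> space (prob_algebra T)" and \<epsilon>: "0 < \<epsilon>"
  defines "A \<equiv> {x \<in> space Pn. (\<integral>\<^sup>+ \<theta>. exp_neg \<alpha> (r x \<theta>) / G \<theta> \<partial>\<pi>) \<le> ennreal (1 / \<epsilon>)}"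
  shows "A \<in> sets Pn" and "1 - \<epsilon> \<le> measure Pn A"
proof -
  have sets [measurable_cong]: "sets \<pi> = sets T" and "prob_space \<pi>"
    using \<pi> by (auto simp: space_prob_algebra)
  interpret \<pi>: prob_space \<pi> by fact
  interpret pair_prob_space Pn \<pi> ..
  have space: "space \<pi> = space T"
    using sets by (rule sets_eq_imp_space_eq)
  note [measurable] = r_measurable[OF sets] G_measurable[OF sets]
  define u where "u x = (\<integral>\<^sup>+ \<theta>. exp_neg \<alpha> (r x \<theta>) / G \<theta> \<partial>\<pi>)" for x
  have [measurable]: "u \<in> borel_measurable Pn"
    unfolding u_def by measurable
  show A: "A \<in> sets Pn"
    unfolding A_def u_def[symmetric] by measurable
  have "(\<integral>\<^sup>+ x. u x \<partial>Pn) = (\<integral>\<^sup>+ \<theta>. \<integral>\<^sup>+ x. exp_neg \<alpha> (r x \<theta>) / G \<theta> \<partial>Pn \<partial>\<pi>)"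
    unfolding u_def by (rule Fubini'[symmetric]) measurable
  also have "\<dots> \<le> (\<integral>\<^sup>+ \<theta>. 1 \<partial>\<pi>)"
    by (intro nn_integral_mono nn_integral_exp_neg_divide_G_le) (simp add: space)
  finally have u: "(\<integral>\<^sup>+ x. u x \<partial>Pn) \<le> 1"
    by (simp add: \<pi>.emeasure_space_1)
  have "emeasure Pn (space Pn - A) \<le> emeasure Pn {x \<in> space Pn. 1 \<le> ennreal \<epsilon> * u x}"
  proof (intro emeasure_mono)
    have "1 \<le> ennreal \<epsilon> * u x" if "ennreal (1 / \<epsilon>) < u x" for x
    proof -
      have "ennreal \<epsilon> * ennreal (1 / \<epsilon>) \<le> ennreal \<epsilon> * u x"
        using that by (intro mult_left_mono) auto
      then show ?thesis
        using \<epsilon> by (simp flip: ennreal_mult)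
    qed
    then show "space Pn - A \<subseteq> {x \<in> space Pn. 1 \<le> ennreal \<epsilon> * u x}"
      by (auto simp: A_def u_def not_le)
  qed measurable
  also have "\<dots> \<le> ennreal \<epsilon> * (\<integral>\<^sup>+ x. u x * indicator (space Pn) x \<partial>Pn)"
    by (rule nn_integral_Markov_inequality) auto
  also have "\<dots> \<le> ennreal \<epsilon> * 1"
    using u by (intro mult_left_mono) (auto cong: nn_integral_cong)
  finally have "measure Pn (space Pn - A) \<le> \<epsilon>"
    using \<epsilon> by (simp add: Pn.emeasure_eq_measure)
  then show "1 - \<epsilon> \<le> measure Pn A"
    using Pn.prob_compl[OF A] by simp
qed

section \<open>Moments of the log-likelihood ratio averaged over a fixed distribution\<close>

context
  fixes \<rho> :: "'t measure" and e :: real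
  assumes \<rho>: "\<rho> \<in> space (prob_algebra T)" and e: "0 < e"
    and KL: "ext_integral \<rho> (\<lambda>\<theta>. KL_ext (P \<theta>0) (P \<theta>)) \<le> ereal e"
    and sq: "\<And>i. i \<in> {1..n} \<Longrightarrow> ext_integral \<rho> (\<lambda>\<theta>. ext_integral Pn
      (\<lambda>x. (ln_ext (ennreal (p \<theta> (x i)) / ennreal (p \<theta>0 (x i))))\<^sup>2)) \<le> ereal e"
begin

lemma sets_\<rho> [measurable_cong]: "sets \<rho> = sets T"
  using \<rho> by (simp add: space_prob_algebra)

lemma space_\<rho>: "space \<rho> = space T"
  by (rule sets_eq_imp_space_eq) (rule sets_\<rho>)

interpretation \<rho>: prob_space \<rho>
  using \<rho> by (simp add: space_prob_algebra)

interpretation pair_prob_space Pn \<rho> ..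

abbreviation "rr x \<theta> \<equiv> real_of_ereal (r x \<theta>)"
abbreviation "m \<theta> \<equiv> \<integral>x. rr x \<theta> \<partial>Pn"

lemmas [measurable] = r_measurable[OF sets_\<rho>]

lemma r_swap_measurable [measurable]: "(\<lambda>(\<theta>, x). r x \<theta>) \<in> borel_measurable (\<rho> \<Otimes>\<^sub>M Pn)"
  using measurable_pair_swap[OF r_measurable[OF sets_\<rho>]] by (simp add: split_beta')

lemma m_measurable [measurable]: "(\<lambda>\<theta>. m \<theta>) \<in> borel_measurable \<rho>"
  by measurable

abbreviation "sq_mom \<theta> \<equiv> prob_densities.sq_moment Q (p \<theta>) (p \<theta>0)"

text \<open>The observations are identically distributed, so the hypothesis at index 1, available
  since \<open>n \<ge> 1\<close>, determines the single-observation moment.\<close>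

lemma nn_integral_sq_mom: "(\<integral>\<^sup>+ \<theta>. sq_mom \<theta> \<partial>\<rho>) \<le> ennreal e"
proof -
  have 1: "1 \<in> {1..n}"
    using n by simp
  have "ext_integral Pn (\<lambda>x. (ln_ext (ennreal (p \<theta> (x 1)) / ennreal (p \<theta>0 (x 1))))\<^sup>2) =
      enn2ereal (sq_mom \<theta>)" if "\<theta> \<in> space \<rho>" for \<theta>
    using prob_densities.ext_integral_sq_llr[OF densities[of \<theta>] finite_atLeastAtMost _ 1] that n
    unfolding Pn_eq space_\<rho> by auto
  then have "(\<integral>\<^sup>+ \<theta>. sq_mom \<theta> \<partial>\<rho>) = (\<integral>\<^sup>+ \<theta>. e2ennreal (ext_integral Pn
      (\<lambda>x. (ln_ext (ennreal (p \<theta> (x 1)) / ennreal (p \<theta>0 (x 1))))\<^sup>2)) \<partial>\<rho>)"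
      "ext_integral \<rho> (\<lambda>\<theta>. ext_integral Pn
        (\<lambda>x. (ln_ext (ennreal (p \<theta> (x 1)) / ennreal (p \<theta>0 (x 1))))\<^sup>2)) =
       enn2ereal (\<integral>\<^sup>+ \<theta>. e2ennreal (ext_integral Pn
        (\<lambda>x. (ln_ext (ennreal (p \<theta> (x 1)) / ennreal (p \<theta>0 (x 1))))\<^sup>2)) \<partial>\<rho>)"
    by (auto intro!: nn_integral_cong ext_integral_nonneg)
  with sq[OF 1] show ?thesis
    by (auto intro: enn2ereal_le_ereal)
qed

text \<open>\<open>nn_integral\<close> is a lower integral for non-measurable integrands, such as \<open>g\<close> here.\<close>

lemma nn_integral_le_cmult:
  assumes [measurable]: "f \<in> borel_measurable \<rho>" and le: "\<And>\<theta>. \<theta> \<in> space \<rho> \<Longrightarrow> f \<theta> \<le> ennreal c * g \<theta>"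
    and "0 < c" and "(\<integral>\<^sup>+ \<theta>. g \<theta> \<partial>\<rho>) \<le> ennreal b"
  shows "(\<integral>\<^sup>+ \<theta>. f \<theta> \<partial>\<rho>) \<le> ennreal c * ennreal b"
proof -
  have c: "ennreal c * ennreal (1 / c) = 1"
    using assms(3) by (simp flip: ennreal_mult)
  \<comment> \<open>The constant is moved to the side of the measurable \<open>f\<close>; for
    \<open>g\<close> only monotonicity of the integral is used.\<close>
  have "(\<integral>\<^sup>+ \<theta>. f \<theta> \<partial>\<rho>) = ennreal c * (ennreal (1 / c) * (\<integral>\<^sup>+ \<theta>. f \<theta> \<partial>\<rho>))"
    by (simp add: c flip: mult.assoc)
  also have "ennreal (1 / c) * (\<integral>\<^sup>+ \<theta>. f \<theta> \<partial>\<rho>) = (\<integral>\<^sup>+ \<theta>. ennreal (1 / c) * f \<theta> \<partial>\<rho>)"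
    by (rule nn_integral_cmult[symmetric]) measurable
  also have "\<dots> \<le> (\<integral>\<^sup>+ \<theta>. g \<theta> \<partial>\<rho>)"
  proof (intro nn_integral_mono)
    fix \<theta> assume "\<theta> \<in> space \<rho>"
    then have "ennreal (1 / c) * f \<theta> \<le> ennreal (1 / c) * (ennreal c * g \<theta>)"
      by (intro mult_left_mono le) auto
    then show "ennreal (1 / c) * f \<theta> \<le> g \<theta>"
      using c by (simp add: mult.commute[of "ennreal (1 / c)"] flip: mult.assoc)
  qed
  also have "\<dots> \<le> ennreal b" by fact
  finally show ?thesis
    by (simp add: mult_left_mono)
qed

text \<open>The first bound yields joint integrability, the second feeds Chebyshev's inequality and
  the third bounds the mean.\<close>

lemma moments:
  shows "(\<integral>\<^sup>+ \<theta>. \<integral>\<^sup>+ x. e2ennreal ((r x \<theta>)\<^sup>2) \<partial>Pn \<partial>\<rho>) \<le> ennreal ((real n)\<^sup>2) * ennreal e"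
    and "(\<integral>\<^sup>+ \<theta>. \<integral>\<^sup>+ x. ennreal ((rr x \<theta> - m \<theta>)\<^sup>2) \<partial>Pn \<partial>\<rho>) \<le> ennreal (real n) * ennreal e"
    and "(\<integral>\<^sup>+ \<theta>. ennreal (m \<theta>) \<partial>\<rho>) \<le> ennreal (real n) * ennreal e"
proof -
  have llr: "(\<integral>\<^sup>+ x. e2ennreal ((r x \<theta>)\<^sup>2) \<partial>Pn) \<le> ennreal ((real n)\<^sup>2) * sq_mom \<theta>"
      "(\<integral>\<^sup>+ x. ennreal ((rr x \<theta> - m \<theta>)\<^sup>2) \<partial>Pn) \<le> ennreal (real n) * sq_mom \<theta>"
      "ennreal (m \<theta> / n) \<le> e2ennreal (KL_ext (P \<theta>0) (P \<theta>))"
    if "\<theta> \<in> space \<rho>" for \<theta>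
  proof -
    have \<theta>: "\<theta> \<in> space T" using that by (simp add: space_\<rho>)
    note D = densities[OF \<theta>]
    have I: "finite {1..n}" "{1..n} \<noteq> {}" "card {1..n} = n"
      using n by auto
    show "(\<integral>\<^sup>+ x. e2ennreal ((r x \<theta>)\<^sup>2) \<partial>Pn) \<le> ennreal ((real n)\<^sup>2) * sq_mom \<theta>"
      "(\<integral>\<^sup>+ x. ennreal ((rr x \<theta> - m \<theta>)\<^sup>2) \<partial>Pn) \<le> ennreal (real n) * sq_mom \<theta>"
      using prob_densities.moments_llr_le[OF D I(1,2)]
      unfolding r_eq_llr[OF \<theta>] Pn_eq I(3) by blast+
    show "ennreal (m \<theta> / n) \<le> e2ennreal (KL_ext (P \<theta>0) (P \<theta>))"
      using prob_densities.mean_llr_le_KL[OF D I(1,2)]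
      unfolding r_eq_llr[OF \<theta>] Pn_eq I(3) P_eq[OF \<theta>0] P_eq[OF \<theta>] .
  qed
  have [measurable]: "(\<lambda>(\<theta>, x). e2ennreal ((r x \<theta>)\<^sup>2)) \<in> borel_measurable (\<rho> \<Otimes>\<^sub>M Pn)"
    unfolding power2_eq_square by measurable
  show "(\<integral>\<^sup>+ \<theta>. \<integral>\<^sup>+ x. e2ennreal ((r x \<theta>)\<^sup>2) \<partial>Pn \<partial>\<rho>) \<le> ennreal ((real n)\<^sup>2) * ennreal e"
    using n by (intro nn_integral_le_cmult[OF _ llr(1) _ nn_integral_sq_mom]) auto
  show "(\<integral>\<^sup>+ \<theta>. \<integral>\<^sup>+ x. ennreal ((rr x \<theta> - m \<theta>)\<^sup>2) \<partial>Pn \<partial>\<rho>) \<le> ennreal (real n) * ennreal e"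
    using n by (intro nn_integral_le_cmult[OF _ llr(2) _ nn_integral_sq_mom]) auto
  have "0 \<le> KL_ext (P \<theta>0) (P \<theta>)" if "\<theta> \<in> space \<rho>" for \<theta>
    using that \<theta>0 prob P_eq by (intro KL_ext_nonneg) (auto simp: space_\<rho>)
  then have KL': "(\<integral>\<^sup>+ \<theta>. e2ennreal (KL_ext (P \<theta>0) (P \<theta>)) \<partial>\<rho>) \<le> ennreal e"
    using KL by (intro enn2ereal_le_ereal) (simp add: ext_integral_nonneg)
  show "(\<integral>\<^sup>+ \<theta>. ennreal (m \<theta>) \<partial>\<rho>) \<le> ennreal (real n) * ennreal e"
  proof (rule nn_integral_le_cmult[OF _ _ _ KL'])
    fix \<theta> assume "\<theta> \<in> space \<rho>"
    have "ennreal (m \<theta>) = ennreal n * ennreal (m \<theta> / n)"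
      using n by (cases "0 \<le> m \<theta>") (auto simp: ennreal_neg divide_nonpos_pos simp flip: ennreal_mult)
    also have "\<dots> \<le> ennreal n * e2ennreal (KL_ext (P \<theta>0) (P \<theta>))"
      using llr(3)[OF \<open>\<theta> \<in> space \<rho>\<close>] by (rule mult_left_mono) simp
    finally show "ennreal (m \<theta>) \<le> ennreal (real n) * e2ennreal (KL_ext (P \<theta>0) (P \<theta>))" .
  qed (use n in auto)
qed

text \<open>A finite second moment on the product space excludes infinite values and, the product
  being a probability space, gives integrability.\<close>

lemma AE_r_finite: "AE z in Pn \<Otimes>\<^sub>M \<rho>. \<bar>r (fst z) (snd z)\<bar> \<noteq> \<infinity>"
  and integrable_rr: "integrable (Pn \<Otimes>\<^sub>M \<rho>) (\<lambda>(x, \<theta>). rr x \<theta>)"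
proof -
  have sq_meas: "(\<lambda>z. e2ennreal ((r (fst z) (snd z))\<^sup>2)) \<in> borel_measurable (Pn \<Otimes>\<^sub>M \<rho>)"
    unfolding power2_eq_square by measurable
  have rr_meas: "(\<lambda>z. rr (fst z) (snd z)) \<in> borel_measurable (Pn \<Otimes>\<^sub>M \<rho>)"
    by measurable
  have "(\<integral>\<^sup>+ z. e2ennreal ((r (fst z) (snd z))\<^sup>2) \<partial>(Pn \<Otimes>\<^sub>M \<rho>)) =
      (\<integral>\<^sup>+ \<theta>. \<integral>\<^sup>+ x. e2ennreal ((r x \<theta>)\<^sup>2) \<partial>Pn \<partial>\<rho>)"
    using nn_integral_snd[OF sq_meas] by simp
  also have "\<dots> < \<infinity>"
    using moments(1) by (rule order_le_less_trans) (simp add: ennreal_mult_less_top)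
  finally have fin: "(\<integral>\<^sup>+ z. e2ennreal ((r (fst z) (snd z))\<^sup>2) \<partial>(Pn \<Otimes>\<^sub>M \<rho>)) < \<infinity>" .
  then have "AE z in Pn \<Otimes>\<^sub>M \<rho>. e2ennreal ((r (fst z) (snd z))\<^sup>2) \<noteq> \<infinity>"
    by (intro nn_integral_PInf_AE sq_meas) auto
  then show AE: "AE z in Pn \<Otimes>\<^sub>M \<rho>. \<bar>r (fst z) (snd z)\<bar> \<noteq> \<infinity>"
    by eventually_elim (auto simp: power2_eq_square)
  have "(\<integral>\<^sup>+ z. ennreal ((rr (fst z) (snd z))\<^sup>2) \<partial>(Pn \<Otimes>\<^sub>M \<rho>)) =
      (\<integral>\<^sup>+ z. e2ennreal ((r (fst z) (snd z))\<^sup>2) \<partial>(Pn \<Otimes>\<^sub>M \<rho>))"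
    by (intro nn_integral_cong_AE eventually_mono[OF AE]) auto
  with fin have fin': "(\<integral>\<^sup>+ z. ennreal ((rr (fst z) (snd z))\<^sup>2) \<partial>(Pn \<Otimes>\<^sub>M \<rho>)) < \<infinity>"
    by (simp only:)
  have "integrable (Pn \<Otimes>\<^sub>M \<rho>) (\<lambda>z. (rr (fst z) (snd z))\<^sup>2)"
    by (rule integrableI_nonneg[OF borel_measurable_power[OF rr_meas] AE_I2[OF zero_le_power2] fin'])
  then show "integrable (Pn \<Otimes>\<^sub>M \<rho>) (\<lambda>(x, \<theta>). rr x \<theta>)"
    unfolding split_beta' by (rule P.square_integrable_imp_integrable[OF rr_meas])
qed

lemma AE_sample:
  "AE x in Pn. integrable \<rho> (\<lambda>\<theta>. rr x \<theta>) \<and> (AE \<theta> in \<rho>. \<bar>r x \<theta>\<bar> \<noteq> \<infinity>)"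
  using AE_integrable_fst'[OF integrable_rr] AE_pair[OF AE_r_finite] by eventually_elim auto

lemma mean_le: "(\<integral>x. (\<integral>\<theta>. rr x \<theta> \<partial>\<rho>) \<partial>Pn) \<le> n * e"
proof -
  have "(\<integral>x. (\<integral>\<theta>. rr x \<theta> \<partial>\<rho>) \<partial>Pn) = (\<integral>\<theta>. m \<theta> \<partial>\<rho>)"
    using Fubini_integral[OF integrable_rr] by simp
  \<comment> \<open>Only the positive part of \<open>m\<close> is kept, which is what
    \<open>moments\<close> bounds.\<close>
  also have "\<dots> \<le> enn2real (\<integral>\<^sup>+ \<theta>. ennreal (m \<theta>) \<partial>\<rho>)"
    using integrable_snd[of "\<lambda>x \<theta>. rr x \<theta>"] integrable_rr
    by (subst real_lebesgue_integral_def) auto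
  also have "\<dots> \<le> n * e"
    using moments(3) e by (intro enn2real_leI) (auto simp: ennreal_mult)
  finally show ?thesis .
qed

text \<open>The deviation \<open>sqrt (n * e / \<eta>)\<close> is the one at which a variance bound
  \<open>n * e\<close> leaves probability \<eta> in Chebyshev's inequality.\<close>

lemma prob_mean_llr_le:
  assumes \<eta>: "0 < \<eta>"
  defines "A \<equiv> {x \<in> space Pn. (\<integral>\<theta>. rr x \<theta> \<partial>\<rho>) \<le> n * e + sqrt (n * e / \<eta>)}"
  shows "A \<in> sets Pn" and "1 - \<eta> \<le> measure Pn A"
proof -
  define R where "R x = (\<integral>\<theta>. rr x \<theta> \<partial>\<rho>)" for x
  have [measurable]: "R \<in> borel_measurable Pn"
    unfolding R_def by measurable
  show A: "A \<in> sets Pn"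
    unfolding A_def R_def[symmetric] by measurable
  define \<mu> where "\<mu> = (\<integral>x. R x \<partial>Pn)"
  have int_m: "integrable \<rho> m"
    using integrable_snd[of "\<lambda>x \<theta>. rr x \<theta>"] integrable_rr by auto
  have \<mu>: "\<mu> = (\<integral>\<theta>. m \<theta> \<partial>\<rho>)"
    using Fubini_integral[OF integrable_rr] by (simp add: \<mu>_def R_def)
  have ne: "0 < n * e"
    using n e by simp
  \<comment> \<open>Jensen is applied over \<rho> for almost every sample; exchanging the integrals
    then leaves the variances at fixed \<theta>.\<close>
  have "(\<integral>\<^sup>+ x. ennreal ((R x - \<mu>)\<^sup>2) \<partial>Pn) \<le>
      (\<integral>\<^sup>+ x. \<integral>\<^sup>+ \<theta>. ennreal ((rr x \<theta> - m \<theta>)\<^sup>2) \<partial>\<rho> \<partial>Pn)"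
  proof (intro nn_integral_mono_AE eventually_mono[OF AE_sample])
    fix x assume x: "integrable \<rho> (\<lambda>\<theta>. rr x \<theta>) \<and> (AE \<theta> in \<rho>. \<bar>r x \<theta>\<bar> \<noteq> \<infinity>)"
    then have "R x - \<mu> = (\<integral>\<theta>. rr x \<theta> - m \<theta> \<partial>\<rho>)"
      using int_m by (simp add: R_def \<mu>)
    then show "ennreal ((R x - \<mu>)\<^sup>2) \<le> (\<integral>\<^sup>+ \<theta>. ennreal ((rr x \<theta> - m \<theta>)\<^sup>2) \<partial>\<rho>)"
      using x int_m \<rho>.square_integral_le_nn_integral[of "\<lambda>\<theta>. rr x \<theta> - m \<theta>"] by simp
  qed
  also have "\<dots> = (\<integral>\<^sup>+ \<theta>. \<integral>\<^sup>+ x. ennreal ((rr x \<theta> - m \<theta>)\<^sup>2) \<partial>Pn \<partial>\<rho>)"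
    by (rule Fubini'[symmetric]) measurable
  also have "\<dots> \<le> ennreal (n * e)"
    using moments(2) e by (simp add: ennreal_mult)
  finally have var: "(\<integral>\<^sup>+ x. ennreal ((R x - \<mu>)\<^sup>2) \<partial>Pn) \<le> ennreal (n * e)" .
  have "emeasure Pn (space Pn - A) \<le>
      emeasure Pn {x \<in> space Pn. 1 \<le> ennreal (\<eta> / (n * e)) * ennreal ((R x - \<mu>)\<^sup>2)}"
  proof (intro emeasure_mono subsetI)
    fix x assume x: "x \<in> space Pn - A"
    \<comment> \<open>Chebyshev is centred at the true mean \<mu>, and \<open>mean_le\<close> gives
      \<open>\<mu> \<le> n * e\<close>.\<close>
    then have "sqrt (n * e / \<eta>) \<le> R x - \<mu>"
      using mean_le by (auto simp: A_def R_def \<mu>_def)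
    then have "n * e / \<eta> \<le> (R x - \<mu>)\<^sup>2"
      using ne \<eta> by (intro sqrt_le_D) auto
    then have "1 \<le> \<eta> / (n * e) * (R x - \<mu>)\<^sup>2"
      using ne \<eta> by (simp add: field_simps)
    then show "x \<in> {x \<in> space Pn. 1 \<le> ennreal (\<eta> / (n * e)) * ennreal ((R x - \<mu>)\<^sup>2)}"
      using x ne \<eta> by (auto simp flip: ennreal_mult ennreal_1 intro!: ennreal_leI)
  qed measurable
  also have "\<dots> \<le> ennreal (\<eta> / (n * e)) *
      (\<integral>\<^sup>+ x. ennreal ((R x - \<mu>)\<^sup>2) * indicator (space Pn) x \<partial>Pn)"
    by (rule nn_integral_Markov_inequality) auto
  also have "\<dots> = ennreal (\<eta> / (n * e)) * (\<integral>\<^sup>+ x. ennreal ((R x - \<mu>)\<^sup>2) \<partial>Pn)"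
    by (auto intro!: arg_cong2[where f="(*)"] nn_integral_cong)
  also have "\<dots> \<le> ennreal (\<eta> / (n * e)) * ennreal (n * e)"
    using var by (rule mult_left_mono) simp
  also have "\<dots> = ennreal \<eta>"
    using n e \<eta> by (simp flip: ennreal_mult)
  finally have "measure Pn (space Pn - A) \<le> \<eta>"
    using \<eta> by (simp add: Pn.emeasure_eq_measure)
  then show "1 - \<eta> \<le> measure Pn A"
    using Pn.prob_compl[OF A] by simp
qed

end

section \<open>Deterministic bound for a fixed sample\<close>

context
  fixes x :: "nat \<Rightarrow> 'x"
  assumes x: "x \<in> space Pn" and pos: "\<And>i. i \<in> {1..n} \<Longrightarrow> 0 < p \<theta>0 (x i)"
begin

lemma p_sample_nonneg:
  assumes "\<theta> \<in> space T" "i \<in> {1..n}"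
  shows "0 \<le> p \<theta> (x i)"
proof -
  have "x i \<in> space (P \<theta>0)"
    using x assms(2) unfolding Pn_def space_PiM by (rule PiE_mem)
  then show ?thesis
    using assms(1) by (intro p_nonneg) (auto simp: P_eq[OF \<theta>0])
qed

lemma r_not_MInf:
  assumes "\<theta> \<in> space T"
  shows "r x \<theta> \<noteq> - \<infinity>"
  unfolding log_lik_ratio_def using assms
  by (subst sum_ln_ext) (auto intro: pos p_sample_nonneg)

lemma tempered_likelihood_eq:
  assumes "\<theta> \<in> space T"
  shows "ennreal ((\<Prod>i\<in>{1..n}. p \<theta> (x i)) powr \<alpha>) =
    ennreal ((\<Prod>i\<in>{1..n}. p \<theta>0 (x i)) powr \<alpha>) * exp_neg \<alpha> (r x \<theta>)"
proof -
  have "exp_neg \<alpha> (r x \<theta>) = (\<Prod>i\<in>{1..n}. ennreal ((p \<theta> (x i) / p \<theta>0 (x i)) powr \<alpha>))"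
    unfolding log_lik_ratio_def using assms \<alpha>
    by (intro exp_neg_sum_ln_ext) (auto intro: pos p_sample_nonneg)
  also have "\<dots> = ennreal (\<Prod>i\<in>{1..n}. (p \<theta> (x i) / p \<theta>0 (x i)) powr \<alpha>)"
    by (rule prod_ennreal) simp
  also have "(\<Prod>i\<in>{1..n}. (p \<theta> (x i) / p \<theta>0 (x i)) powr \<alpha>) =
      (\<Prod>i\<in>{1..n}. p \<theta> (x i) / p \<theta>0 (x i)) powr \<alpha>"
    by (rule prod_powr_distrib[symmetric])
  also have "(\<Prod>i\<in>{1..n}. p \<theta> (x i) / p \<theta>0 (x i)) =
      (\<Prod>i\<in>{1..n}. p \<theta> (x i)) / (\<Prod>i\<in>{1..n}. p \<theta>0 (x i))"
    by (rule prod_dividef)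
  finally have eq: "exp_neg \<alpha> (r x \<theta>) =
      ennreal (((\<Prod>i\<in>{1..n}. p \<theta> (x i)) / (\<Prod>i\<in>{1..n}. p \<theta>0 (x i))) powr \<alpha>)" .
  have "0 \<le> (\<Prod>i\<in>{1..n}. p \<theta> (x i))"
    using assms by (intro prod_nonneg p_sample_nonneg)
  moreover have "0 < (\<Prod>i\<in>{1..n}. p \<theta>0 (x i))"
    by (intro prod_pos pos)
  ultimately show ?thesis
    unfolding eq powr_divide
    by (metis ennreal_mult less_irrefl nonzero_mult_div_cancel_left powr_gt_zero powr_ge_zero
      times_divide_eq_right divide_nonneg_nonneg)
qed

text \<open>Likelihood and \<open>exp_neg \<alpha> (r x \<theta>)\<close> differ by the factor
  \<open>c\<close>, which does not depend on \<theta> and cancels in the normalization.\<close>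

lemma tempered_posterior_eq_gibbs:
  assumes \<pi>: "sets \<pi> = sets T" and gibbs: "gibbs_measure \<pi> (r x) \<alpha>"
  shows "tempered_posterior p n \<alpha> \<pi> x = gibbs_measure.gibbs \<pi> (r x) \<alpha>"
proof -
  interpret gibbs_measure \<pi> "r x" \<alpha> by fact
  define c where "c = (\<Prod>i\<in>{1..n}. p \<theta>0 (x i)) powr \<alpha>"
  have c: "0 < c"
  proof -
    have "0 < (\<Prod>i\<in>{1..n}. p \<theta>0 (x i))"
      by (intro prod_pos pos)
    then show ?thesis
      unfolding c_def powr_gt_zero by (rule less_imp_neq[symmetric])
  qed
  have space: "space \<pi> = space T"
    using \<pi> by (rule sets_eq_imp_space_eq)
  have lik: "ennreal ((\<Prod>i\<in>{1..n}. p \<theta> (x i)) powr \<alpha>) = ennreal c * exp_neg \<alpha> (r x \<theta>)"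
    if "\<theta> \<in> space \<pi>" for \<theta>
    using tempered_likelihood_eq[of \<theta>] that unfolding space c_def by blast
  have "(\<integral>\<^sup>+ \<theta>. ennreal ((\<Prod>i\<in>{1..n}. p \<theta> (x i)) powr \<alpha>) \<partial>\<pi>) = ennreal (c * Z)"
    using c Z by (subst nn_integral_cong[OF lik]) (simp_all add: nn_integral_cmult ennreal_mult)
  moreover have "ennreal ((\<Prod>i\<in>{1..n}. p \<theta> (x i)) powr \<alpha>) / ennreal (c * Z) =
      exp_neg \<alpha> (r x \<theta>) / ennreal Z" if "\<theta> \<in> space \<pi>" for \<theta>
    using c Z(1) exp_neg_less_top[of \<alpha> "r x \<theta>"] unfolding lik[OF that]
    by (cases "exp_neg \<alpha> (r x \<theta>)") (auto simp: divide_ennreal simp flip: ennreal_mult)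
  ultimately have ratio: "ennreal ((\<Prod>i\<in>{1..n}. p \<theta> (x i)) powr \<alpha>) /
      (\<integral>\<^sup>+ \<theta>'. ennreal ((\<Prod>i\<in>{1..n}. p \<theta>' (x i)) powr \<alpha>) \<partial>\<pi>) = exp_neg \<alpha> (r x \<theta>) / ennreal Z"
    if "\<theta> \<in> space \<pi>" for \<theta>
    using that by simp
  have "(\<lambda>\<theta>. exp_neg \<alpha> (r x \<theta>) / ennreal Z) \<in> borel_measurable \<pi>"
    by measurable
  then show ?thesis
    unfolding tempered_posterior_def gibbs_def
    \<comment> \<open>Measurability in \<theta> of the normalized likelihood is inherited from the
      Gibbs density, with which it agrees on the space.\<close>
    by (intro density_cong AE_I2 ratio) (simp_all only: measurable_cong[OF ratio])
qed

text \<open>\<rho> is the competitor: minimality bounds the divergence of \<rho>' from the tempered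
  posterior by \<open>\<alpha> * a + b + ln Z\<close>, and \<open>integral_le_KL_ext_gibbs\<close>
  turns this into a bound on the risk.\<close>

lemma risk_le:
  assumes \<pi>: "\<pi> \<in> space (prob_algebra T)" and F: "F \<subseteq> space (prob_algebra T)" and \<rho>: "\<rho> \<in> F"
    and r_int: "integrable \<rho> (\<lambda>\<theta>. real_of_ereal (r x \<theta>))" and r_fin: "AE \<theta> in \<rho>. \<bar>r x \<theta>\<bar> \<noteq> \<infinity>"
    and r_le: "(\<integral>\<theta>. real_of_ereal (r x \<theta>) \<partial>\<rho>) \<le> a"
    and KL: "KL_ext \<rho> \<pi> \<le> ereal b"
    and C: "0 < C" "(\<integral>\<^sup>+ \<theta>. exp_neg \<alpha> (r x \<theta>) / G \<theta> \<partial>\<pi>) \<le> ennreal C"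
    and \<rho>': "variational_approximation p \<theta>0 n \<alpha> \<pi> F x \<rho>'"
  shows "ext_integral \<rho>' (\<lambda>\<theta>. renyi_divergence Q \<alpha> (P \<theta>) (P \<theta>0)) \<le>
    ereal ((\<alpha> * a + b + ln C) / (n * (1 - \<alpha>)))"
proof -
  have "\<rho>' \<in> F"
    using \<rho>' by (auto simp: variational_approximation_def is_arg_min_def)
  then have prob_sets: "prob_space \<pi>" "prob_space \<rho>" "prob_space \<rho>'"
      "sets \<pi> = sets T" "sets \<rho> = sets T" "sets \<rho>' = sets T"
    using \<pi> \<rho> F by (auto simp: space_prob_algebra)
  then have sets: "sets \<rho> = sets \<pi>" "sets \<rho>' = sets \<pi>"
    by auto
  have space: "space \<pi> = space T" "space \<rho>' = space T"
    using prob_sets by (auto dest: sets_eq_imp_space_eq)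
  interpret \<pi>: prob_space \<pi> by fact
  interpret \<rho>: prob_space \<rho> by fact
  have r_meas [measurable]: "r x \<in> borel_measurable \<pi>"
    using r_section_measurable(2)[OF x] prob_sets(4) by (simp cong: measurable_cong_sets)
  have KL_fin: "KL_ext \<rho> \<pi> < \<infinity>"
    using KL by (rule order_le_less_trans) simp
  have ac: "absolutely_continuous \<pi> \<rho>"
    using KL_fin by (auto simp: KL_ext_def split: if_splits)
  \<comment> \<open>The normalizer is positive: otherwise \<open>r x\<close> would be infinite
    almost everywhere under \<pi>, hence under \<rho>, contrary to \<open>r_fin\<close>.\<close>
  have "(\<integral>\<^sup>+ \<theta>. exp_neg \<alpha> (r x \<theta>) \<partial>\<pi>) \<noteq> 0"
  proof
    assume "(\<integral>\<^sup>+ \<theta>. exp_neg \<alpha> (r x \<theta>) \<partial>\<pi>) = 0"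
    then have "AE \<theta> in \<pi>. exp_neg \<alpha> (r x \<theta>) = 0"
      by (subst (asm) nn_integral_0_iff_AE) auto
    then have "AE \<theta> in \<rho>. exp_neg \<alpha> (r x \<theta>) = 0"
      by (rule absolutely_continuous_AE[OF sets(1) ac])
    with r_fin have "AE \<theta> in \<rho>. False"
      by eventually_elim (auto simp: exp_neg_def ennreal_eq_0_iff not_le split: if_splits)
    then show False
      by simp
  qed
  \<comment> \<open>The normalizer is finite: since \<open>G \<le> 1\<close>, dividing by
    \<open>G\<close> only increases the integrand, and that integral is at most
    \<open>C\<close>.\<close>
  moreover have "(\<integral>\<^sup>+ \<theta>. exp_neg \<alpha> (r x \<theta>) \<partial>\<pi>) < \<infinity>"
  proof -
    have "u \<le> u / g" if g: "g \<le> 1" for u g :: ennreal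
    proof (cases "g = 0 \<or> u = \<infinity>")
      case True
      with g show ?thesis
        by (cases "u = 0") (auto simp: ennreal_top_divide top_unique)
    next
      case False
      then obtain v t where vt: "u = ennreal v" "g = ennreal t" "0 \<le> v" "0 < t"
        using g by (cases u; cases g) (auto simp: top_unique less_le)
      then have "v * t \<le> v"
        using g by (intro mult_left_le) auto
      with vt show ?thesis
        by (simp add: divide_ennreal pos_le_divide_eq ennreal_leI)
    qed
    then have "(\<integral>\<^sup>+ \<theta>. exp_neg \<alpha> (r x \<theta>) \<partial>\<pi>) \<le> (\<integral>\<^sup>+ \<theta>. exp_neg \<alpha> (r x \<theta>) / G \<theta> \<partial>\<pi>)"
      by (intro nn_integral_mono) (simp add: G_def)
    also have "\<dots> < \<infinity>"
      using C(2) by (rule order_le_less_trans) simp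
    finally show ?thesis .
  qed
  ultimately have gibbs: "gibbs_measure \<pi> (r x) \<alpha>"
    using r_not_MInf \<alpha> by unfold_locales (auto simp: space zero_less_iff_neq_zero)
  interpret gibbs_measure \<pi> "r x" \<alpha> by (rule gibbs)
  have post: "tempered_posterior p n \<alpha> \<pi> x = gibbs"
    using prob_sets(4) gibbs by (rule tempered_posterior_eq_gibbs)
  have ext_r: "ext_integral \<rho> (r x) = ereal (\<integral>\<theta>. real_of_ereal (r x \<theta>) \<partial>\<rho>)"
    using r_int by (rule ext_integral_eq_integral) (use r_fin in \<open>auto elim!: eventually_mono simp: ereal_real\<close>)
  have bound: "ereal \<alpha> * ext_integral \<rho> (r x) + KL_ext \<rho> \<pi> \<le> ereal (\<alpha> * a + b)"
  proof -
    have "ereal \<alpha> * ext_integral \<rho> (r x) \<le> ereal (\<alpha> * a)"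
      using r_le \<alpha> by (simp add: ext_r)
    then have "ereal \<alpha> * ext_integral \<rho> (r x) + KL_ext \<rho> \<pi> \<le> ereal (\<alpha> * a) + ereal b"
      using KL by (rule add_mono)
    then show ?thesis by simp
  qed
  have KL_gibbs: "KL_ext \<rho>' gibbs \<le> ereal (\<alpha> * a + b + ln Z)"
    using \<rho>' unfolding variational_approximation_def
  proof
    assume "is_arg_min (\<lambda>\<rho>. KL_ext \<rho> (tempered_posterior p n \<alpha> \<pi> x)) (\<lambda>\<rho>. \<rho> \<in> F) \<rho>'"
    then have "KL_ext \<rho>' gibbs \<le> KL_ext \<rho> gibbs"
      using \<rho> by (auto simp: is_arg_min_def post not_less)
    also have "\<dots> = ereal \<alpha> * ext_integral \<rho> (r x) + KL_ext \<rho> \<pi> + ereal (ln Z)"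
      unfolding ext_r using prob_sets(2) sets(1) KL_fin
      by (rule KL_ext_gibbs(3)) (simp add: ext_r)
    also have "\<dots> \<le> ereal (\<alpha> * a + b) + ereal (ln Z)"
      using bound by (rule add_right_mono)
    finally show ?thesis by simp
  next
    assume "is_arg_min (\<lambda>\<rho>. ereal \<alpha> * ext_integral \<rho> (r x) + KL_ext \<rho> \<pi>) (\<lambda>\<rho>. \<rho> \<in> F) \<rho>'"
    then have "ereal \<alpha> * ext_integral \<rho>' (r x) + KL_ext \<rho>' \<pi> \<le>
        ereal \<alpha> * ext_integral \<rho> (r x) + KL_ext \<rho> \<pi>"
      using \<rho> by (auto simp: is_arg_min_def not_less)
    also note bound
    finally have J: "ereal \<alpha> * ext_integral \<rho>' (r x) + KL_ext \<rho>' \<pi> \<le> ereal (\<alpha> * a + b)" .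
    \<comment> \<open>In \<open>ereal\<close> a sum with a summand \<infinity> is \<infinity>, even
      against - \<infinity>, so the finite upper bound excludes \<infinity> from both terms. The
      Gibbs identity then holds at \<rho>', whereas the first case used it at \<rho>.\<close>
    have "ext_integral \<rho>' (r x) \<noteq> \<infinity>" "KL_ext \<rho>' \<pi> \<noteq> \<infinity>"
      using J \<alpha> by auto
    then have fin: "ext_integral \<rho>' (r x) < \<infinity>" "KL_ext \<rho>' \<pi> < \<infinity>"
      by auto
    note KL' = KL_ext_gibbs[OF prob_sets(3) sets(2) fin(2,1)]
    have "ext_integral \<rho>' (r x) = ereal (\<integral>\<theta>. real_of_ereal (r x \<theta>) \<partial>\<rho>')"
      using KL'(1) by (rule ext_integral_eq_integral) (use KL'(2) in \<open>auto elim!: eventually_mono simp: ereal_real\<close>)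
    then have "KL_ext \<rho>' gibbs = ereal \<alpha> * ext_integral \<rho>' (r x) + KL_ext \<rho>' \<pi> + ereal (ln Z)"
      using KL'(3) by simp
    also have "\<dots> \<le> ereal (\<alpha> * a + b) + ereal (ln Z)"
      using J by (rule add_right_mono)
    finally show ?thesis by simp
  qed
  then have "KL_ext \<rho>' gibbs < \<infinity>"
    by (rule order_le_less_trans) simp
  note I = integral_le_KL_ext_gibbs[OF prob_sets(3) sets(2) this G_measurable[OF prob_sets(4)] _ C]
  have G_le: "G \<theta> \<le> 1" for \<theta>
    by (simp add: G_def)
  let ?d = "\<lambda>\<theta>. - ln (enn2real (G \<theta>))"
  \<comment> \<open>The terms \<open>ln Z\<close> cancel here, so no estimate of the normalizer
    enters the bound.\<close>
  have "ereal (\<integral>\<theta>. ?d \<theta> \<partial>\<rho>') \<le> ereal (\<alpha> * a + b + ln Z) + ereal (ln C - ln Z)"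
    using I(3)[OF G_le] add_right_mono[OF KL_gibbs] by (rule order_trans)
  then have d_le: "(\<integral>\<theta>. ?d \<theta> \<partial>\<rho>') \<le> \<alpha> * a + b + ln C"
    by simp
  have "ext_integral \<rho>' (\<lambda>\<theta>. renyi_divergence Q \<alpha> (P \<theta>) (P \<theta>0)) =
      ereal (\<integral>\<theta>. ?d \<theta> / (n * (1 - \<alpha>)) \<partial>\<rho>')"
  proof (rule ext_integral_eq_integral)
    show "integrable \<rho>' (\<lambda>\<theta>. ?d \<theta> / (n * (1 - \<alpha>)))"
      using I(2)[OF G_le] by (rule integrable_divide_zero)
    show "AE \<theta> in \<rho>'. renyi_divergence Q \<alpha> (P \<theta>) (P \<theta>0) = ereal (?d \<theta> / (n * (1 - \<alpha>)))"
      using I(1)[OF G_le] AE_space by eventually_elim (simp add: renyi_divergence_eq_G space)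
  qed
  also have "(\<integral>\<theta>. ?d \<theta> / (n * (1 - \<alpha>)) \<partial>\<rho>') = (\<integral>\<theta>. ?d \<theta> \<partial>\<rho>') / (n * (1 - \<alpha>))"
    by (rule integral_divide_zero)
  also have "\<dots> \<le> (\<alpha> * a + b + ln C) / (n * (1 - \<alpha>))"
    using d_le \<alpha>(2) by (intro divide_right_mono mult_nonneg_nonneg) auto
  finally show ?thesis by simp
qed

end

end

section \<open>Combination of the two events\<close>

theorem theorem2p4:
  fixes T :: "'t measure" and Q :: "'x measure"
    and P :: "'t \<Rightarrow> 'x measure" and p :: "'t \<Rightarrow> 'x \<Rightarrow> real"
    and \<theta>0 :: 't and n :: nat
    and \<pi> \<rho>n :: "'t measure" and F :: "'t measure set"
    and \<epsilon>n \<alpha> \<epsilon> \<eta> :: real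
    and \<pi>t :: "(nat \<Rightarrow> 'x) \<Rightarrow> 't measure"
  defines "Pn \<equiv> Pi\<^sub>M {1..n} (\<lambda>_. P \<theta>0)"
  assumes model: "\<And>\<theta>. \<theta> \<in> space T \<Longrightarrow> prob_space (P \<theta>)"
    and dominated: "\<And>\<theta>. \<theta> \<in> space T \<Longrightarrow> p \<theta> \<in> borel_measurable Q"
      "\<And>\<theta> y. \<theta> \<in> space T \<Longrightarrow> y \<in> space Q \<Longrightarrow> 0 \<le> p \<theta> y"
      "\<And>\<theta>. \<theta> \<in> space T \<Longrightarrow> P \<theta> = density Q (\<lambda>y. ennreal (p \<theta> y))"
    and "\<theta>0 \<in> space T"
    and "1 \<le> n"
    and joint_measurable:
      "(\<lambda>(x, \<theta>). log_lik_ratio p n \<theta> \<theta>0 x) \<in> borel_measurable (Pn \<Otimes>\<^sub>M T)"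
    and prior: "\<pi> \<in> space (prob_algebra T)"
    and family: "F \<subseteq> space (prob_algebra T)"
    and "0 < \<epsilon>n"
    and "\<rho>n \<in> F"
    and KL_bound: "ext_integral \<rho>n (\<lambda>\<theta>. KL_ext (P \<theta>0) (P \<theta>)) \<le> ereal \<epsilon>n"
    and log2_bound: "\<And>i. i \<in> {1..n} \<Longrightarrow>
      ext_integral \<rho>n (\<lambda>\<theta>. ext_integral Pn
        (\<lambda>x. (ln_ext (ennreal (p \<theta> (x i)) / ennreal (p \<theta>0 (x i))))\<^sup>2)) \<le> ereal \<epsilon>n"
    and prior_mass: "KL_ext \<rho>n \<pi> \<le> ereal (real n * \<epsilon>n)"
    and "0 < \<alpha>" "\<alpha> < 1" and "0 < \<epsilon>" "\<epsilon> < 1" and "0 < \<eta>" "\<eta> < 1"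
    and minimizer: "AE x in Pn. variational_approximation p \<theta>0 n \<alpha> \<pi> F x (\<pi>t x)"
    and risk_measurable:
      "(\<lambda>x. ext_integral (\<pi>t x) (\<lambda>\<theta>. renyi_divergence Q \<alpha> (P \<theta>) (P \<theta>0))) \<in> borel_measurable Pn"
  shows "measure Pn {x \<in> space Pn.
      ext_integral (\<pi>t x) (\<lambda>\<theta>. renyi_divergence Q \<alpha> (P \<theta>) (P \<theta>0)) \<le>
        ereal (((\<alpha> + 1) * \<epsilon>n + \<alpha> * sqrt (\<epsilon>n / (real n * \<eta>)) + ln (1 / \<epsilon>) / real n) / (1 - \<alpha>))}
    \<ge> 1 - \<epsilon> - \<eta>"
proof -
  interpret M: tempered_model T Q p P \<theta>0 n \<alpha>
    using model dominated \<open>\<theta>0 \<in> space T\<close> \<open>1 \<le> n\<close> joint_measurable[unfolded Pn_def] \<open>0 < \<alpha>\<close> \<open>\<alpha> < 1\<close>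
    by (rule tempered_model.intro)
  have Pn: "M.Pn = Pn"
    by (simp add: M.Pn_def Pn_def)
  \<comment> \<open>Both densities are taken to be \<open>p \<theta>0\<close>, in order to obtain
    its almost sure positivity under its own law.\<close>
  interpret prob_densities Q "p \<theta>0" "p \<theta>0"
    using \<open>\<theta>0 \<in> space T\<close> by (rule M.densities)
  have \<rho>n: "\<rho>n \<in> space (prob_algebra T)"
    using family \<open>\<rho>n \<in> F\<close> by blast
  let ?risk = "\<lambda>x. ext_integral (\<pi>t x) (\<lambda>\<theta>. renyi_divergence Q \<alpha> (P \<theta>) (P \<theta>0))"
  let ?a = "n * \<epsilon>n + sqrt (n * \<epsilon>n / \<eta>)"
  define B where "B = ((\<alpha> + 1) * \<epsilon>n + \<alpha> * sqrt (\<epsilon>n / (real n * \<eta>)) + ln (1 / \<epsilon>) / real n) / (1 - \<alpha>)"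
  \<comment> \<open>\<open>?a\<close> bounds the averaged log-likelihood ratio (mean plus
    deviation), \<open>n * \<epsilon>n\<close> the divergence from the prior, and
    \<open>1 / \<epsilon>\<close> is the constant \<open>C\<close> of
    \<open>M.risk_le\<close>.\<close>
  have B: "B = (\<alpha> * ?a + n * \<epsilon>n + ln (1 / \<epsilon>)) / (n * (1 - \<alpha>))"
  proof -
    have "sqrt (n * \<epsilon>n / \<eta>) = n * sqrt (\<epsilon>n / (n * \<eta>))"
    proof -
      have "n * \<epsilon>n / \<eta> = (real n)\<^sup>2 * (\<epsilon>n / (n * \<eta>))"
        using \<open>1 \<le> n\<close> \<open>0 < \<eta>\<close> by (simp add: field_simps power2_eq_square)
      then show ?thesis
        by (simp only: real_sqrt_mult real_sqrt_abs abs_of_nat)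
    qed
    then have "\<alpha> * ?a + n * \<epsilon>n + ln (1 / \<epsilon>) =
        n * ((\<alpha> + 1) * \<epsilon>n + \<alpha> * sqrt (\<epsilon>n / (real n * \<eta>)) + ln (1 / \<epsilon>) / real n)"
      using \<open>1 \<le> n\<close> by (simp add: algebra_simps)
    then show ?thesis
      using \<open>1 \<le> n\<close> by (simp add: B_def)
  qed
  define A1 where "A1 = {x \<in> space Pn. (\<integral>\<^sup>+ \<theta>. exp_neg \<alpha> (log_lik_ratio p n \<theta> \<theta>0 x) / M.G \<theta> \<partial>\<pi>) \<le> ennreal (1 / \<epsilon>)}"
  define A2 where "A2 = {x \<in> space Pn. (\<integral>\<theta>. real_of_ereal (log_lik_ratio p n \<theta> \<theta>0 x) \<partial>\<rho>n) \<le> ?a}"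
  note A1 = M.prob_exp_moment_le[OF prior \<open>0 < \<epsilon>\<close>, unfolded Pn, folded A1_def]
  note A2 = M.prob_mean_llr_le[OF \<rho>n \<open>0 < \<epsilon>n\<close> KL_bound log2_bound[folded Pn] \<open>0 < \<eta>\<close>,
      unfolded Pn, folded A2_def]
  have "AE y in P \<theta>0. 0 < p \<theta>0 y"
    using AE_density_pos unfolding dominated(3)[OF \<open>\<theta>0 \<in> space T\<close>] .
  then have pos: "AE x in Pn. \<forall>i\<in>{1..n}. 0 < p \<theta>0 (x i)"
    unfolding Pn_def using model[OF \<open>\<theta>0 \<in> space T\<close>]
    by (subst AE_finite_all) (auto intro!: AE_PiM_component)
  have sample: "AE x in Pn. integrable \<rho>n (\<lambda>\<theta>. real_of_ereal (log_lik_ratio p n \<theta> \<theta>0 x)) \<and>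
      (AE \<theta> in \<rho>n. \<bar>log_lik_ratio p n \<theta> \<theta>0 x\<bar> \<noteq> \<infinity>)"
    using M.AE_sample[OF \<rho>n \<open>0 < \<epsilon>n\<close> KL_bound log2_bound[folded Pn]] unfolding Pn .
  have "1 - \<epsilon> - \<eta> \<le> measure Pn (A1 \<inter> A2)"
  proof -
    \<comment> \<open>Inclusion-exclusion; the two failure probabilities add up, with no
      independence of the events.\<close>
    have "measure Pn (A1 \<union> A2) = measure Pn A1 + measure Pn A2 - measure Pn (A1 \<inter> A2)"
      using M.Pn.finite_measure_Union'[of A1 A2] M.Pn.finite_measure_Diff'[of A2 A1] A1(1) A2(1)
      by (simp add: Pn Int_commute)
    moreover have "measure Pn (A1 \<union> A2) \<le> 1"
      using M.Pn.prob_le_1[of "A1 \<union> A2"] by (simp add: Pn)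
    ultimately show ?thesis
      using A1(2) A2(2) by linarith
  qed
  also have "\<dots> \<le> measure Pn {x \<in> space Pn. ?risk x \<le> ereal B}"
  \<comment> \<open>The inclusion holds up to a null set: positivity of \<open>p \<theta>0\<close>
    at the observations, integrability of \<open>r\<close> under \<open>\<rho>n\<close> and the
    minimizer property each hold almost surely.\<close>
  proof (rule M.Pn.finite_measure_mono_AE[unfolded Pn])
    show "AE x in Pn. x \<in> A1 \<inter> A2 \<longrightarrow> x \<in> {x \<in> space Pn. ?risk x \<le> ereal B}"
      using pos sample minimizer
    proof eventually_elim
      case (elim x)
      show ?case
      proof
        assume x: "x \<in> A1 \<inter> A2"
        then have "x \<in> space M.Pn"
          by (simp add: A1_def Pn)
        moreover have "0 < 1 / \<epsilon>"
          using \<open>0 < \<epsilon>\<close> by simp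
        ultimately have "?risk x \<le> ereal B"
          unfolding B using x elim prior family \<open>\<rho>n \<in> F\<close> prior_mass
          by (intro M.risk_le) (auto simp: A1_def A2_def)
        then show "x \<in> {x \<in> space Pn. ?risk x \<le> ereal B}"
          using x by (simp add: A1_def)
      qed
    qed
    show "{x \<in> space Pn. ?risk x \<le> ereal B} \<in> sets Pn"
      using risk_measurable by measurable
  qed
  finally show ?thesis
    by (simp add: B_def)
qed

end
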